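(* Let $\Omega\subset\mathbb{R}^d$ be any open set and let $u\in L^p(\Omega)$, $1\le p<\infty$. For $x\in\Omega$ let $\delta_x=\mathrm{dist}(x,\partial\Omega)$, $S_\Omega(x)=\{w\in\mathbb{S}^{d-1}:\lim_{r\to\infty}\mathbf{1}_{\Omega^c}(x+rw)=1\}$ and $|S_\Omega(x)|=\sigma_{d-1}(S_\Omega(x))$. Then: (1) For $u\in\bigcup_{0<s<1}L^p(\Omega,\delta_x^{-sp})$, $$\lim_{s\to0^+}s\int_\Omega|u(x)|^p\int_{\mathbb{R}^d\setminus\Omega}\frac{dy}{|x-y|^{d+sp}}\,dx=\frac1p\int_\Omega|u(x)|^p\,|S_\Omega(x)|\,dx.$$ (2) For $u\in\bigcup_{0<s<1}\big(W^{s,p}(\Omega)\cap L^p(\Omega,\delta_x^{-sp})\big)$, $$\lim_{s\to0^+}s(1-s)\iint_{\Omega\times\Omega}\frac{|u(x)-u(y)|^p}{|x-y|^{d+sp}}\,dy\,dx=\frac2p\int_\Omega\big(|\mathbb{S}^{d-1}|-|S_\Omega(x)|\big)|u(x)|^p\,dx.$$ (3) Assume that either $\Omega$ has a compact Lipschitz boundary, or $\Omega=\{x=(x',x_d):x_d>\zeta(x')\}$ is the epigraph of a Lipschitz function $\zeta:\mathbb{R}^{d-1}\to\mathbb{R}$. Then for $u\in\bigcup_{0<s<1}W^{s,p}(\Omega)$, $$\lim_{s\to0^+}s(1-s)\iint_{\Omega\times\Omega}\frac{|u(x)-u(y)|^p}{|x-y|^{d+sp}}\,dy\,dx=\frac2p\int_\Omega\big(|\mathbb{S}^{d-1}|-|S_\Omega(x)|\big)|u(x)|^p\,dx.$$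 (4) Under the conditions of item (2) or of item (3), the limit $\lim_{s\to0^+}s(1-s)\iint_{\Omega\times\Omega}\frac{|u(x)-u(y)|^p}{|x-y|^{d+sp}}\,dy\,dx$ equals $0$ if $\Omega$ is bounded; equals $\frac{2|\mathbb{S}^{d-1}|}{p}\|u\|^p_{L^p(\Omega)}$ if $\Omega^c$ is bounded; and equals $\frac{|\mathbb{S}^{d-1}|}{p}\|u\|^p_{L^p(\mathbb{R}^d_+)}$ if $\Omega=\mathbb{R}^d_+$.
   Context: $\Omega^c=\mathbb{R}^d\setminus\Omega$; $\mathbb{R}^d_+=\{x\in\mathbb{R}^d:x_d>0\}$; $\sigma_{d-1}$ is the surface measure on the unit sphere $\mathbb{S}^{d-1}$ and $|\mathbb{S}^{d-1}|=\sigma_{d-1}(\mathbb{S}^{d-1})$. $L^p(\Omega,\delta_x^{-sp})$ is the space of measurable $u$ with $\int_\Omega|u(x)|^p\delta_x^{-sp}\,dx<\infty$. For $0<s<1$, $W^{s,p}(\Omega)$ is the set of $u\in L^p(\Omega)$ with $\iint_{\Omega\times\Omega}\frac{|u(x)-u(y)|^p}{|x-y|^{d+sp}}\,dy\,dx<\infty$. $S_\Omega(x)$ is called the escape sector at $x$.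
   Formalization: In (1), (2) and the epigraph case of (3) it is assumed additionally that for a.e. x in Ω and a.e. direction w the limit of 1_{Ω^c}(x+rw) as r→∞ exists; without this the claims fail, e.g. for (1), (2) with Ω the union of the intervals (2k,2k+1). *)

theory Defs
  imports "HOL-Analysis.Analysis"
begin

text \<open>Euclidean space of dimension \<open>d\<close> is a type \<open>'a\<close> of class \<^class>\<open>euclidean_space\<close> with
  \<open>d = DIM('a)\<close>. All integrals are nonnegative Lebesgue integrals with values in \<^typ>\<open>ennreal\<close>,
  so that divergence is recorded as \<open>\<infinity>\<close> and never as a default value.\<close>

section \<open>Surface measure on the unit sphere\<close>

text \<open>Standard construction by polar coordinates: \<open>\<sigma>(A)\<close> is \<open>d\<close> times the Lebesgue measure of the
  cone \<open>{t *\<^sub>R w | 0 < t < 1, w \<in> A}\<close>, i.e. \<open>\<sigma>\<close> is the image of \<open>d\<close> times Lebesgue measure on the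
  unit ball under \<open>x \<mapsto> x / norm x\<close> (which is \<^const>\<open>sgn\<close>). It is a Borel measure on the whole space,
  concentrated on the sphere; see \<open>emeasure_sphere_measure\<close> below.\<close>

definition sphere_measure :: "'a::euclidean_space measure" where
  "sphere_measure = distr (density lborel (\<lambda>x. of_nat DIM('a) * indicator (ball 0 1) x)) borel sgn"

lemma sgn_borel_measurable: "(sgn :: 'a::euclidean_space \<Rightarrow> 'a) \<in> borel_measurable borel"
  unfolding sgn_div_norm by measurable

lemma emeasure_sphere_measure:
  fixes A :: "'a::euclidean_space set"
  assumes "A \<in> sets borel" "A \<subseteq> sphere 0 1"
  shows "emeasure sphere_measure A
    = of_nat DIM('a) * emeasure lborel {t *\<^sub>R w | t w. 0 < t \<and> t < 1 \<and> w \<in> A}"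
proof -
  have cone: "{t *\<^sub>R w | t w. 0 < t \<and> t < 1 \<and> w \<in> A} = sgn -` A \<inter> ball 0 1" (is "?C = _")
  proof (intro equalityI subsetI)
    fix x assume "x \<in> ?C"
    then obtain t w where *: "x = t *\<^sub>R w" "0 < t" "t < 1" "w \<in> A" by blast
    moreover have "norm w = 1" using * assms(2) by auto
    ultimately show "x \<in> sgn -` A \<inter> ball 0 1" by (simp add: sgn_div_norm)
  next
    fix x assume x: "x \<in> sgn -` A \<inter> ball 0 1"
    then have "norm (sgn x) = 1" using assms(2) by auto
    then have "x \<noteq> 0" by auto
    then have "x = norm x *\<^sub>R sgn x" by (simp add: sgn_div_norm)
    then show "x \<in> ?C" using x \<open>x \<noteq> 0\<close> by (auto intro!: exI[of _ "norm x"] exI[of _ "sgn x"])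
  qed
  have m: "sgn -` A \<in> sets (borel :: 'a measure)"
    using measurable_sets[OF sgn_borel_measurable assms(1)] by simp
  have "emeasure sphere_measure A
    = emeasure (density lborel (\<lambda>x::'a. of_nat DIM('a) * indicator (ball 0 1) x)) (sgn -` A)"
    unfolding sphere_measure_def using assms(1) sgn_borel_measurable
    by (subst emeasure_distr) (auto simp: measurable_cong_sets[of "density _ _" borel])
  also have "\<dots> = (\<integral>\<^sup>+x. of_nat DIM('a) * indicator (sgn -` A \<inter> ball 0 1) x \<partial>lborel)"
    using m by (subst emeasure_density) (auto intro!: nn_integral_cong simp: indicator_def)
  also have "\<dots> = of_nat DIM('a) * emeasure lborel (sgn -` A \<inter> ball 0 1)"
    using m by (subst nn_integral_cmult_indicator) auto
  finally show ?thesis by (simp only: cone)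
qed

definition sphere_area :: "'a::euclidean_space set \<Rightarrow> real" where
  "sphere_area A = measure sphere_measure A"

section \<open>The escape sector\<close>

definition escape_sector :: "'a::euclidean_space set \<Rightarrow> 'a \<Rightarrow> 'a set" where
  "escape_sector \<Omega> x =
     {w \<in> sphere 0 1. ((\<lambda>r. indicator (- \<Omega>) (x + r *\<^sub>R w) :: real) \<longlongrightarrow> 1) at_top}"

text \<open>The definition of the escape sector speaks of the limit of the indicator of the complement
  along rays and so presupposes that this limit exists (its value is then 0 or 1). The
  following predicate makes the presupposition explicit, up to null sets. It cannot be dropped: for
  \<open>\<Omega> = (\<Union>k::int. {2k<..<2k+1})\<close> in dimension one all escape sectors are empty, whereas
  \<open>s * (\<integral>\<^sup>+y\<in>-\<Omega>. \<bar>x - y\<bar> powr (-1-s*p))\<close> tends to \<open>1 / p\<close> as \<open>s\<close> tends to 0.\<close>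

definition radial_limits_exist :: "'a::euclidean_space set \<Rightarrow> bool" where
  "radial_limits_exist \<Omega> \<longleftrightarrow>
     (AE x in lebesgue. x \<in> \<Omega> \<longrightarrow>
       (AE w in sphere_measure. \<exists>l. ((\<lambda>r. indicator (- \<Omega>) (x + r *\<^sub>R w) :: real) \<longlongrightarrow> l) at_top))"

section \<open>Function spaces\<close>

definition Lp_space :: "'a::euclidean_space set \<Rightarrow> real \<Rightarrow> ('a \<Rightarrow> real) set" where
  "Lp_space \<Omega> p = {u \<in> borel_measurable (lebesgue_on \<Omega>).
     (\<integral>\<^sup>+x\<in>\<Omega>. ennreal (\<bar>u x\<bar> powr p) \<partial>lebesgue) < \<infinity>}"

text \<open>The weight \<open>dist(x, frontier \<Omega>) powr (- t)\<close>. The distance to the empty set is \<open>\<infinity>\<close>, so the weight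
  is 0 if \<open>\<Omega>\<close> is the whole space; \<^const>\<open>infdist\<close> to the empty set would be 0 instead.\<close>

definition boundary_weight :: "'a::euclidean_space set \<Rightarrow> real \<Rightarrow> 'a \<Rightarrow> real" where
  "boundary_weight \<Omega> t x =
     (if frontier \<Omega> = {} then 0 else infdist x (frontier \<Omega>) powr (- t))"

definition weighted_Lp_space :: "'a::euclidean_space set \<Rightarrow> real \<Rightarrow> real \<Rightarrow> ('a \<Rightarrow> real) set" where
  "weighted_Lp_space \<Omega> s p = {u \<in> borel_measurable (lebesgue_on \<Omega>).
     (\<integral>\<^sup>+x\<in>\<Omega>. ennreal (\<bar>u x\<bar> powr p * boundary_weight \<Omega> (s * p) x) \<partial>lebesgue) < \<infinity>}"

definition gagliardo :: "'a::euclidean_space set \<Rightarrow> real \<Rightarrow> real \<Rightarrow> ('a \<Rightarrow> real) \<Rightarrow> ennreal" where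
  "gagliardo \<Omega> s p u =
     (\<integral>\<^sup>+x\<in>\<Omega>. (\<integral>\<^sup>+y\<in>\<Omega>. ennreal (\<bar>u x - u y\<bar> powr p / norm (x - y) powr (real DIM('a) + s * p))
        \<partial>lebesgue) \<partial>lebesgue)"

definition frac_Sobolev :: "'a::euclidean_space set \<Rightarrow> real \<Rightarrow> real \<Rightarrow> ('a \<Rightarrow> real) set" where
  "frac_Sobolev \<Omega> s p = {u \<in> Lp_space \<Omega> p. gagliardo \<Omega> s p u < \<infinity>}"

section \<open>Lipschitz domains\<close>

text \<open>For a unit vector \<open>e\<close>, a point \<open>x\<close> has last coordinate \<open>x \<bullet> e\<close> and remaining coordinates
  \<open>x - (x \<bullet> e) *\<^sub>R e\<close>, the hyperplane orthogonal to \<open>e\<close> playing the role of the space of dimension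
  \<open>d - 1\<close>. Only the values of \<open>\<zeta>\<close> on this hyperplane matter. This includes \<open>d = 1\<close>.\<close>

definition epigraph_along :: "'a::euclidean_space \<Rightarrow> ('a \<Rightarrow> real) \<Rightarrow> 'a set" where
  "epigraph_along e \<zeta> = {x. x \<bullet> e > \<zeta> (x - (x \<bullet> e) *\<^sub>R e)}"

definition Lipschitz_off :: "'a::euclidean_space \<Rightarrow> ('a \<Rightarrow> real) \<Rightarrow> bool" where
  "Lipschitz_off e \<zeta> \<longleftrightarrow> (\<exists>L. L-lipschitz_on {y. y \<bullet> e = 0} \<zeta>)"

text \<open>Near each boundary point and after a rotation of the coordinates, \<open>\<Omega>\<close> coincides with the
  epigraph of a Lipschitz function.\<close>

definition Lipschitz_boundary :: "'a::euclidean_space set \<Rightarrow> bool" where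
  "Lipschitz_boundary \<Omega> \<longleftrightarrow>
     (\<forall>z\<in>frontier \<Omega>. \<exists>r>0. \<exists>e \<zeta>. norm e = 1 \<and> Lipschitz_off e \<zeta> \<and>
        \<Omega> \<inter> ball z r = epigraph_along e \<zeta> \<inter> ball z r)"

end

theory Submission
  imports Defs
begin

text \<open>As \<open>s\<close> tends to 0, the measure \<open>s * norm z powr (- d - s * p) dz\<close> on the outside of a ball keeps
  a bounded total mass, while the mass of every bounded region tends to 0. Limits therefore see only what
  happens far away, where it is described by directions. This is made precise by
  \<open>riesz_integral_tendsto\<close>: if a bounded \<open>f\<close> vanishes near the origin and \<open>f (t z)\<close> tends to \<open>g z\<close> as
  \<open>t\<close> tends to infinity, for almost every \<open>z\<close> in the unit ball, then \<open>a\<close> times the integral of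
  \<open>f z * norm z powr (- d - a)\<close> tends to \<open>d\<close> times the integral of \<open>g\<close> over the unit ball, which is the
  integral of \<open>g\<close> over the sphere. The layer cake formula \<open>riesz_integral_eq\<close> turns the singular integral
  into an average over \<open>\<tau>\<close> of the ball integrals of \<open>f (\<tau> powr (- 1 / a) z)\<close>, to which dominated
  convergence applies.

  With \<open>f\<close> the indicator of the complement of \<open>\<Omega>\<close> seen from a point \<open>x\<close> of \<open>\<Omega>\<close>, the limit is the area of
  the escape sector at \<open>x\<close>. The integral over \<open>x\<close> follows by dominated convergence, the majorant being
  \<open>\<bar>u\<bar> powr p\<close> times one plus the weight; this is the first limit (\<open>escape_term_tendsto\<close>).

  For the Gagliardo seminorm (\<open>gagliardo_tendsto\<close>), pairs at distance less than 1 are controlled by the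
  seminorm of a fixed order, so the factor \<open>s\<close> removes them. For the remaining pairs
  \<open>\<bar>u x - u y\<bar> powr p\<close> can be replaced by \<open>\<bar>u x\<bar> powr p + \<bar>u y\<bar> powr p\<close>: the error, integrated over \<open>x\<close>
  with \<open>y = x + z\<close>, tends to 0 as \<open>z\<close> tends to infinity, since an \<open>L\<^sup>p\<close> function and its far translate
  are almost disjoint (\<open>power_defect_integral_tendsto_0\<close>). Hence \<open>riesz_integral_tendsto\<close> with \<open>g = 0\<close>
  shows that the error is negligible. By symmetry the sum contributes twice the
  integral of \<open>\<bar>u x\<bar> powr p\<close> against the mass of \<open>\<Omega>\<close> outside \<open>ball x 1\<close>, and this mass
  tends to the area of the directions that do not escape.

  Radial limits exist when the frontier is bounded, since a ray is eventually disjoint from it and the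
  tail of the ray is connected. For a half-space only the directions parallel to its boundary have to be
  excluded, and the reflection \<open>w \<mapsto> - w\<close> shows that escaping directions fill half the sphere.\<close>

section \<open>Riesz-type integrals of small order\<close>

lemma ball_in_borel [measurable]: "ball (x::'a::euclidean_space) r \<in> sets borel"
  by simp

lemma nn_integral_lborel_affine:
  fixes f :: "'a::euclidean_space \<Rightarrow> ennreal"
  assumes [measurable]: "f \<in> borel_measurable borel" and c: "c \<noteq> 0"
  shows "(\<integral>\<^sup>+z. f z \<partial>lborel) = ennreal (\<bar>c\<bar> ^ DIM('a)) * (\<integral>\<^sup>+z. f (x + c *\<^sub>R z) \<partial>lborel)"
  by (subst lborel_affine[OF c, of x])
     (simp add: nn_integral_density nn_integral_distr nn_integral_cmult)

lemma nn_integral_ball_scale: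
  fixes f :: "'a::euclidean_space \<Rightarrow> ennreal"
  assumes [measurable]: "f \<in> borel_measurable borel" and t: "t > 0"
  shows "(\<integral>\<^sup>+z. f z * indicator (ball 0 t) z \<partial>lborel)
    = ennreal (t ^ DIM('a)) * (\<integral>\<^sup>+z. f (t *\<^sub>R z) * indicator (ball 0 1) z \<partial>lborel)"
proof -
  have "indicator (ball 0 t) (t *\<^sub>R z) = (indicator (ball 0 1) z :: ennreal)" for z :: 'a
    using t by (auto simp: indicator_def)
  then show ?thesis
    using t by (subst nn_integral_lborel_affine[of _ t 0]) auto
qed

text \<open>The exponent is \<open>d + a\<close>, so that \<open>a\<close> plays the role of \<open>s *
  p\<close>; the value at the origin is 0 because of division by zero.\<close>

definition riesz_kernel :: "real \<Rightarrow> 'a::euclidean_space \<Rightarrow> ennreal" where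
  "riesz_kernel a z = ennreal (1 / norm z powr (real DIM('a) + a))"

lemma riesz_kernel_measurable [measurable]:
  "riesz_kernel a \<in> borel_measurable borel"
  unfolding riesz_kernel_def by measurable

text \<open>The parametrisation \<open>t = \<tau> powr (- 1 / a)\<close> of the level \<open>t\<close> turns
  \<open>a * t powr (- a - 1) dt\<close> into Lebesgue measure \<open>d\<tau>\<close>. The set on
  the left is the interval from 0 to \<open>r powr (- a)\<close>, and the integral of a power over
  it is elementary.\<close>

lemma power_layer_cake:
  fixes d a r :: real
  assumes "a > 0" "r > 0" "d \<ge> 0"
  shows "(\<integral>\<^sup>+\<tau>. ennreal ((d + a) * \<tau> powr (d / a)) * indicator {\<tau>. 0 < \<tau> \<and> r < \<tau> powr (- 1 / a)} \<tau> \<partial>lborel)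
    = ennreal (a * (1 / r powr (d + a)))"
proof -
  define c where "c = r powr (- a)"
  have c: "c > 0" using assms by (simp add: c_def)
  have iff: "r < \<tau> powr (- 1 / a) \<longleftrightarrow> \<tau> < c" if "\<tau> > 0" for \<tau>
  proof -
    have "r < \<tau> powr (- 1 / a) \<longleftrightarrow> ln r < (- 1 / a) * ln \<tau>"
      using assms that ln_less_cancel_iff[of r "\<tau> powr (- 1 / a)"] by simp
    also have "\<dots> \<longleftrightarrow> ln \<tau> < - a * ln r"
    proof -
      have "(- 1 / a) * ln \<tau> = (- ln \<tau>) / a" by simp
      then have "ln r < (- 1 / a) * ln \<tau> \<longleftrightarrow> ln r * a < - ln \<tau>"
        using pos_less_divide_eq[OF \<open>a > 0\<close>] by metis
      then show ?thesis by (auto simp: mult.commute)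
    qed
    also have "\<dots> \<longleftrightarrow> \<tau> < c"
      using assms that ln_less_cancel_iff[of \<tau> c] by (simp add: c_def)
    finally show ?thesis .
  qed
  have "((\<lambda>\<tau>. (d + a) * \<tau> powr (d / a)) has_integral (d + a) * (c powr (d / a + 1) / (d / a + 1))) {0..c}"
    using assms c by (intro has_integral_mult_right has_integral_powr_from_0) (auto intro: less_le_trans[of _ 0])
  also have "(d + a) * (c powr (d / a + 1) / (d / a + 1)) = a * c powr (d / a + 1)"
  proof -
    have "d / a + 1 = (d + a) / a" using assms by (simp add: add_divide_distrib)
    moreover have "d + a \<noteq> 0" using assms by linarith
    ultimately show ?thesis by simp
  qed
  also have "c powr (d / a + 1) = 1 / r powr (d + a)"
  proof -
    have "- a * (d / a + 1) = - (d + a)" using assms by (simp add: distrib_left)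
    then show ?thesis unfolding c_def powr_powr by (simp only: powr_minus_divide)
  qed
  finally have "((\<lambda>\<tau>. (d + a) * \<tau> powr (d / a) * indicator {0..c} \<tau>) has_integral a * (1 / r powr (d + a))) UNIV"
    by (subst (asm) has_integral_restrict_UNIV[symmetric])
       (erule has_integral_cong[THEN iffD1, rotated], auto)
  then have "(\<integral>\<^sup>+\<tau>. ennreal ((d + a) * \<tau> powr (d / a) * indicator {0..c} \<tau>) \<partial>lborel) = ennreal (a * (1 / r powr (d + a)))"
    using assms by (intro nn_integral_has_integral_lborel) (auto split: split_indicator)
  moreover have "(\<integral>\<^sup>+\<tau>. ennreal ((d + a) * \<tau> powr (d / a)) * indicator {\<tau>. 0 < \<tau> \<and> r < \<tau> powr (- 1 / a)} \<tau> \<partial>lborel)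
    = (\<integral>\<^sup>+\<tau>. ennreal ((d + a) * \<tau> powr (d / a) * indicator {0..c} \<tau>) \<partial>lborel)"
  proof (rule nn_integral_cong_AE)
    show "AE \<tau> in lborel. ennreal ((d + a) * \<tau> powr (d / a)) * indicator {\<tau>. 0 < \<tau> \<and> r < \<tau> powr (- 1 / a)} \<tau>
       = ennreal ((d + a) * \<tau> powr (d / a) * indicator {0..c} \<tau>)"
      using AE_lborel_singleton[of 0] AE_lborel_singleton[of c]
      by eventually_elim (use iff in \<open>auto split: split_indicator\<close>)
  qed
  ultimately show ?thesis by simp
qed

text \<open>The kernel is written as an integral over \<open>\<tau>\<close> by the layer cake formula, and
  Tonelli's theorem yields integrals of \<open>f\<close> over the balls of radius \<open>t =
  \<tau> powr (- 1 / a)\<close>; scaling these to the unit ball produces the factor \<open>t ^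
  d\<close>, which cancels \<open>\<tau> powr (d / a)\<close>. As \<open>a\<close> tends to 0,
  \<open>\<tau> powr (- 1 / a)\<close> tends to infinity for every \<open>\<tau> < 1\<close>,
  whereas the outer measure no longer depends on \<open>a\<close>.\<close>

lemma riesz_integral_eq:
  fixes f :: "'a::euclidean_space \<Rightarrow> ennreal"
  assumes [measurable]: "f \<in> borel_measurable borel" and a: "a > 0"
  shows "ennreal a * (\<integral>\<^sup>+z. f z * riesz_kernel a z \<partial>lborel)
    = (\<integral>\<^sup>+\<tau>. indicator {0<..} \<tau> * (ennreal (real DIM('a) + a) *
          (\<integral>\<^sup>+z. f (\<tau> powr (- 1 / a) *\<^sub>R z) * indicator (ball 0 1) z \<partial>lborel)) \<partial>lborel)"
proof -
  define d where "d = real DIM('a)"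
  have d: "d \<ge> 0" by (simp add: d_def)
  define h where "h \<tau> = ennreal ((d + a) * \<tau> powr (d / a))" for \<tau>
  have [measurable]: "h \<in> borel_measurable borel" unfolding h_def by measurable
  have "ennreal a * (\<integral>\<^sup>+z. f z * riesz_kernel a z \<partial>lborel)
    = (\<integral>\<^sup>+z. f z * (ennreal a * riesz_kernel a z) \<partial>lborel)"
    by (subst nn_integral_cmult[symmetric]) (auto simp: ac_simps)
  also have "\<dots> = (\<integral>\<^sup>+z. (\<integral>\<^sup>+\<tau>. f z * (h \<tau> * indicator {\<tau>. 0 < \<tau> \<and> norm z < \<tau> powr (- 1 / a)} \<tau>) \<partial>lborel) \<partial>lborel)"
  proof (rule nn_integral_cong_AE)
    show "AE z in lborel. f z * (ennreal a * riesz_kernel a z)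
      = (\<integral>\<^sup>+\<tau>. f z * (h \<tau> * indicator {\<tau>. 0 < \<tau> \<and> norm z < \<tau> powr (- 1 / a)} \<tau>) \<partial>lborel)"
      using AE_lborel_singleton[of "0::'a"]
    proof eventually_elim
      case (elim z)
      have "(\<integral>\<^sup>+\<tau>. f z * (h \<tau> * indicator {\<tau>. 0 < \<tau> \<and> norm z < \<tau> powr (- 1 / a)} \<tau>) \<partial>lborel)
        = f z * (\<integral>\<^sup>+\<tau>. (h \<tau> * indicator {\<tau>. 0 < \<tau> \<and> norm z < \<tau> powr (- 1 / a)} \<tau>) \<partial>lborel)"
        by (rule nn_integral_cmult) measurable
      also have "\<dots> = f z * ennreal (a * (1 / norm z powr (d + a)))"
        using power_layer_cake[OF a, of "norm z" d] elim d by (simp add: h_def)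
      also have "ennreal (a * (1 / norm z powr (d + a))) = ennreal a * riesz_kernel a z"
        using a unfolding riesz_kernel_def d_def by (subst ennreal_mult) auto
      finally show ?case by simp
    qed
  qed
  also have "\<dots> = (\<integral>\<^sup>+\<tau>. (\<integral>\<^sup>+z. f z * (h \<tau> * indicator {\<tau>. 0 < \<tau> \<and> norm z < \<tau> powr (- 1 / a)} \<tau>) \<partial>lborel) \<partial>lborel)"
    by (rule lborel_pair.Fubini') measurable
  also have "\<dots> = (\<integral>\<^sup>+\<tau>. indicator {0<..} \<tau> * (ennreal (d + a) *
          (\<integral>\<^sup>+z. f (\<tau> powr (- 1 / a) *\<^sub>R z) * indicator (ball 0 1) z \<partial>lborel)) \<partial>lborel)"
  proof (rule nn_integral_cong)
    fix \<tau> :: real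
    show "(\<integral>\<^sup>+z. f z * (h \<tau> * indicator {\<tau>. 0 < \<tau> \<and> norm z < \<tau> powr (- 1 / a)} \<tau>) \<partial>lborel)
      = indicator {0<..} \<tau> * (ennreal (d + a) *
          (\<integral>\<^sup>+z. f (\<tau> powr (- 1 / a) *\<^sub>R z) * indicator (ball 0 1) z \<partial>lborel))"
    proof (cases "\<tau> > 0")
      case True
      define t where "t = \<tau> powr (- 1 / a)"
      have t: "t > 0" using True by (simp add: t_def)
      have ht: "h \<tau> * ennreal (t ^ DIM('a)) = ennreal (d + a)"
      proof -
        have "t ^ DIM('a) = t powr d" using t by (simp add: d_def powr_realpow)
        also have "\<dots> = \<tau> powr (- (d / a))" by (simp add: t_def powr_powr)
        finally have "\<tau> powr (d / a) * t ^ DIM('a) = 1"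
          using True by (simp add: powr_minus)
        then show ?thesis unfolding h_def using t True a d
          by (subst ennreal_mult[symmetric]) (auto simp: mult.assoc)
      qed
      have "(\<integral>\<^sup>+z. f z * (h \<tau> * indicator {\<tau>. 0 < \<tau> \<and> norm z < \<tau> powr (- 1 / a)} \<tau>) \<partial>lborel)
        = (\<integral>\<^sup>+z. h \<tau> * (f z * indicator (ball 0 t) z) \<partial>lborel)"
        using True by (intro nn_integral_cong) (auto simp: t_def mult.commute split: split_indicator)
      also have "\<dots> = h \<tau> * (\<integral>\<^sup>+z. f z * indicator (ball 0 t) z \<partial>lborel)"
        by (rule nn_integral_cmult) measurable
      also have "\<dots> = h \<tau> * ennreal (t ^ DIM('a)) * (\<integral>\<^sup>+z. f (t *\<^sub>R z) * indicator (ball 0 1) z \<partial>lborel)"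
        using t by (subst nn_integral_ball_scale) (auto simp: mult.assoc)
      finally show ?thesis using True unfolding ht unfolding t_def by simp
    qed auto
  qed
  finally show ?thesis by (simp add: d_def)
qed

lemma ball_measure_finite: "emeasure lborel (ball (0::'a::euclidean_space) 1) < \<infinity>"
  using emeasure_lborel_ball_finite[of "0::'a" 1] by simp

text \<open>Only \<open>\<tau> \<le> \<rho> powr (- a)\<close> contributes in the layer cake formula: for
  larger \<open>\<tau>\<close> the scaled unit ball lies where \<open>f\<close> vanishes.\<close>

lemma riesz_integral_le:
  fixes f :: "'a::euclidean_space \<Rightarrow> ennreal"
  assumes [measurable]: "f \<in> borel_measurable borel" and a: "a > 0" and \<rho>: "\<rho> > 0"
    and M: "\<And>z. f z \<le> M" and zero: "\<And>z. norm z < \<rho> \<Longrightarrow> f z = 0"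
  shows "ennreal a * (\<integral>\<^sup>+z. f z * riesz_kernel a z \<partial>lborel)
    \<le> ennreal (real DIM('a) + a) * M * emeasure lborel (ball (0::'a) 1) * ennreal (\<rho> powr (- a))"
proof -
  define B where "B = ennreal (real DIM('a) + a) * (M * emeasure lborel (ball (0::'a) 1))"
  have z: "indicator {0<..} \<tau> * (ennreal (real DIM('a) + a) *
          (\<integral>\<^sup>+z. f (\<tau> powr (- 1 / a) *\<^sub>R z) * indicator (ball 0 1) z \<partial>lborel)) \<le> B * indicator {0..\<rho> powr (- a)} \<tau>" for \<tau> :: real
  proof (cases "0 < \<tau>")
    case True
    show ?thesis
    proof (cases "\<tau> \<le> \<rho> powr (- a)")
      case True
      have "(\<integral>\<^sup>+z. f (\<tau> powr (- 1 / a) *\<^sub>R z) * indicator (ball 0 1) z \<partial>lborel)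
         \<le> (\<integral>\<^sup>+z. M * indicator (ball (0::'a) 1) z \<partial>lborel)"
        using M by (intro nn_integral_mono mult_right_mono) auto
      also have "\<dots> = M * emeasure lborel (ball (0::'a) 1)"
        by (rule nn_integral_cmult_indicator) simp
      finally show ?thesis using \<open>0 < \<tau>\<close> True by (auto simp: B_def intro!: mult_left_mono)
    next
      case False
      have "\<tau> powr (- 1 / a) < (\<rho> powr (- a)) powr (- 1 / a)"
        using False \<rho> a by (intro powr_less_mono2_neg) auto
      then have lt: "\<tau> powr (- 1 / a) < \<rho>" using \<rho> a by (simp add: powr_powr)
      have "f (\<tau> powr (- 1 / a) *\<^sub>R z) * indicator (ball 0 1) z = 0" for z :: 'a
      proof (cases "norm z < 1")
        case True
        then have "\<tau> powr (- 1 / a) * norm z \<le> \<tau> powr (- 1 / a) * 1"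
          by (intro mult_left_mono) auto
        then show ?thesis using lt by (auto intro!: zero)
      qed auto
      then have "(\<integral>\<^sup>+z. f (\<tau> powr (- 1 / a) *\<^sub>R z) * indicator (ball 0 1) z \<partial>lborel) = 0"
        by (subst nn_integral_cong[of _ _ "\<lambda>_. 0"]) auto
      then show ?thesis by simp
    qed
  qed auto
  have "ennreal a * (\<integral>\<^sup>+z. f z * riesz_kernel a z \<partial>lborel) \<le> (\<integral>\<^sup>+\<tau>. B * indicator {0..\<rho> powr (- a)} \<tau> \<partial>lborel)"
    unfolding riesz_integral_eq[OF assms(1) a] by (rule nn_integral_mono) (rule z)
  also have "\<dots> = B * ennreal (\<rho> powr (- a))"
    by (subst nn_integral_cmult_indicator) auto
  finally show ?thesis by (simp add: B_def mult.assoc)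
qed

text \<open>Limits from the right are determined by sequences, for which dominated convergence is known.\<close>

lemma nn_integral_dominated_convergence_at_right:
  fixes F :: "real \<Rightarrow> 'b \<Rightarrow> ennreal" and b :: real
  assumes "0 < b"
    and F: "\<And>s. 0 < s \<Longrightarrow> s < b \<Longrightarrow> F s \<in> borel_measurable M"
    and g: "g \<in> borel_measurable M" and w: "w \<in> borel_measurable M"
    and bound: "\<And>s. 0 < s \<Longrightarrow> s < b \<Longrightarrow> AE x in M. F s x \<le> w x"
    and fin: "(\<integral>\<^sup>+x. w x \<partial>M) < \<infinity>"
    and lim: "AE x in M. ((\<lambda>s. F s x) \<longlongrightarrow> g x) (at_right 0)"
  shows "((\<lambda>s. \<integral>\<^sup>+x. F s x \<partial>M) \<longlongrightarrow> (\<integral>\<^sup>+x. g x \<partial>M)) (at_right 0)"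
proof (rule tendsto_at_right_sequentially[OF \<open>0 < b\<close>])
  fix S :: "nat \<Rightarrow> real"
  assume S: "\<And>n. 0 < S n" "\<And>n. S n < b" "S \<longlonglongrightarrow> 0"
  have fl: "filterlim S (at_right 0) sequentially"
    using S by (auto simp: filterlim_at less_imp_neq[THEN not_sym] intro!: always_eventually)
  show "(\<lambda>n. \<integral>\<^sup>+x. F (S n) x \<partial>M) \<longlonglongrightarrow> (\<integral>\<^sup>+x. g x \<partial>M)"
  proof (rule nn_integral_dominated_convergence[OF _ g w _ fin])
    show "AE x in M. (\<lambda>n. F (S n) x) \<longlonglongrightarrow> g x"
      using lim by eventually_elim (rule filterlim_compose[OF _ fl])
  qed (use S F bound in auto)
qed

text \<open>In the layer cake formula, \<open>\<tau> < 1\<close> gives ball integrals at scales tending to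
  infinity, where they converge to the ball integral of \<open>g\<close>; for \<open>\<tau> >
  1\<close> the scales tend to 0, where \<open>f\<close> vanishes. Hence the integrand in
  \<open>\<tau>\<close> converges to a multiple of the indicator of the unit interval.\<close>

lemma riesz_integral_tendsto:
  fixes f g :: "'a::euclidean_space \<Rightarrow> ennreal"
  assumes f[measurable]: "f \<in> borel_measurable borel" and g[measurable]: "g \<in> borel_measurable borel"
    and M: "\<And>z. f z \<le> M" "M < \<infinity>" and \<rho>: "\<rho> > 0" and zero: "\<And>z. norm z < \<rho> \<Longrightarrow> f z = 0"
    and lim: "AE z in lborel. z \<in> ball 0 1 \<longrightarrow> ((\<lambda>t. f (t *\<^sub>R z)) \<longlongrightarrow> g z) at_top"
  shows "((\<lambda>a. ennreal a * (\<integral>\<^sup>+z. f z * riesz_kernel a z \<partial>lborel))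
    \<longlongrightarrow> of_nat DIM('a) * (\<integral>\<^sup>+z. g z * indicator (ball 0 1) z \<partial>lborel)) (at_right 0)"
proof -
  define m where "m t = (\<integral>\<^sup>+z. f (t *\<^sub>R z) * indicator (ball 0 1) z \<partial>lborel)" for t
  define m0 where "m0 = (\<integral>\<^sup>+z. g z * indicator (ball 0 1) z \<partial>lborel)"
  define V where "V = M * emeasure lborel (ball (0::'a) 1)"
  have V: "V < \<infinity>" using M(2) ball_measure_finite[where 'a='a] by (auto simp: V_def ennreal_mult_less_top)
  have finV: "(\<integral>\<^sup>+z. M * indicator (ball (0::'a) 1) z \<partial>lborel) = V"
    unfolding V_def by (rule nn_integral_cmult_indicator) simp
  have mV: "m t \<le> V" for t
    unfolding m_def finV[symmetric] using M by (intro nn_integral_mono mult_right_mono) auto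
  have m_lim: "(m \<longlongrightarrow> m0) at_top"
  proof (rule tendsto_at_topI_sequentially)
    fix X :: "nat \<Rightarrow> real" assume X: "filterlim X at_top sequentially"
    show "(\<lambda>n. m (X n)) \<longlonglongrightarrow> m0"
      unfolding m_def m0_def
    proof (rule nn_integral_dominated_convergence[where w="\<lambda>z. M * indicator (ball 0 1) z"])
      show "AE z in lborel. (\<lambda>n. f (X n *\<^sub>R z) * indicator (ball 0 1) z) \<longlonglongrightarrow> g z * indicator (ball 0 1) z"
        using lim
      proof eventually_elim
        case (elim z)
        show ?case
        proof (cases "z \<in> ball 0 1")
          case True
          then show ?thesis using filterlim_compose[OF _ X] elim by auto
        qed auto
      qed
      show "(\<lambda>z. f (X n *\<^sub>R z) * indicator (ball 0 1) z) \<in> borel_measurable lborel" for n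
        by measurable
      show "AE z in lborel. f (X n *\<^sub>R z) * indicator (ball 0 1) z \<le> M * indicator (ball 0 1) z" for n
        using M by (auto intro!: mult_right_mono)
      show "(\<lambda>z. g z * indicator (ball 0 1) z) \<in> borel_measurable lborel"
        by measurable
      show "(\<lambda>z. M * indicator (ball 0 1) z) \<in> borel_measurable (lborel :: 'a measure)"
        by measurable
      show "(\<integral>\<^sup>+z. M * indicator (ball (0::'a) 1) z \<partial>lborel) < \<infinity>"
        using finV V by simp
    qed
  qed
  have m0V: "m0 \<le> V"
    using mV by (intro tendsto_upperbound[OF m_lim]) (auto intro: always_eventually)
  define W where "W \<tau> = ennreal (real DIM('a) + 1) * V * indicator {0..max 1 (1 / \<rho>)} \<tau>" for \<tau> :: real
  define G where "G a \<tau> = indicator {0<..} \<tau> * (ennreal (real DIM('a) + a) * m (\<tau> powr (- 1 / a)))" for a \<tau>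
  have [measurable]: "m \<in> borel_measurable borel" unfolding m_def by measurable
  have [measurable]: "G a \<in> borel_measurable borel" for a unfolding G_def by measurable
  \<comment> \<open>Beyond \<open>\<rho> powr (- a)\<close> the scaled ball is contained in the zero set of \<open>f\<close>.\<close>
  have Gzero: "G a \<tau> = 0" if "a > 0" "\<tau> > \<rho> powr (- a)" for a \<tau>
  proof -
    have "\<tau> powr (- 1 / a) < (\<rho> powr (- a)) powr (- 1 / a)"
      using that \<rho> by (intro powr_less_mono2_neg) auto
    then have lt: "\<tau> powr (- 1 / a) < \<rho>" using \<rho> that by (simp add: powr_powr)
    have "f (\<tau> powr (- 1 / a) *\<^sub>R z) * indicator (ball 0 1) z = 0" for z :: 'a
    proof (cases "norm z < 1")
      case True
      then have "\<tau> powr (- 1 / a) * norm z \<le> \<tau> powr (- 1 / a) * 1"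
        by (intro mult_left_mono) auto
      then show ?thesis using lt by (auto intro!: zero)
    qed auto
    then have "m (\<tau> powr (- 1 / a)) = 0"
      unfolding m_def by (subst nn_integral_cong[of _ _ "\<lambda>_. 0"]) auto
    then show ?thesis by (simp add: G_def)
  qed
  \<comment> \<open>For \<open>a < 1\<close> the endpoint \<open>\<rho> powr (- a)\<close> lies between the values 1 and \<open>1 / \<rho>\<close> at the orders 0 and 1.\<close>
  have Gbound: "G a \<tau> \<le> W \<tau>" if "0 < a" "a < 1" for a \<tau>
  proof (cases "0 < \<tau> \<and> \<tau> \<le> \<rho> powr (- a)")
    case True
    have "\<rho> powr (- a) \<le> max 1 (1 / \<rho>)"
    proof (cases "\<rho> \<ge> 1")
      case True
      then have "\<rho> powr (- a) \<le> \<rho> powr 0" using that by (intro powr_mono) auto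
      then show ?thesis using \<rho> by auto
    next
      case False
      then have "\<rho> powr (- a) \<le> \<rho> powr (- 1)" using that \<rho> by (intro powr_mono') auto
      then show ?thesis using \<rho> by (auto simp: powr_minus_divide)
    qed
    then show ?thesis using True that
      by (auto simp: G_def W_def intro!: mult_mono mV ennreal_leI)
  next
    case False
    then have "G a \<tau> = 0" using Gzero[of a \<tau>] that by (auto simp: G_def)
    then show ?thesis by simp
  qed
  have Glim: "((\<lambda>a. G a \<tau>) \<longlongrightarrow> of_nat DIM('a) * m0 * indicator {0<..<1} \<tau>) (at_right 0)" if "\<tau> \<noteq> 1" for \<tau>
  proof -
    consider "\<tau> \<le> 0" | "0 < \<tau>" "\<tau> < 1" | "1 < \<tau>" using \<open>\<tau> \<noteq> 1\<close> by linarith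
    then show ?thesis
    proof cases
      case 1 then show ?thesis by (simp add: G_def)
    next
      case 2
      \<comment> \<open>Here \<open>- ln \<tau> > 0\<close>, so \<open>\<tau> powr (- 1 / a)\<close> tends to infinity.\<close>
      have "filterlim (\<lambda>a::real. - ln \<tau> * inverse a) at_top (at_right 0)"
        using 2 by (intro filterlim_tendsto_pos_mult_at_top[OF tendsto_const] filterlim_inverse_at_top_right) auto
      then have "filterlim (\<lambda>a::real. exp (- ln \<tau> * inverse a)) at_top (at_right 0)"
        by (rule filterlim_compose[OF exp_at_top])
      moreover have "\<tau> powr (- 1 / a) = exp (- ln \<tau> * inverse a)" for a
        using 2 by (simp add: powr_def divide_inverse)
      ultimately have "filterlim (\<lambda>a. \<tau> powr (- 1 / a)) at_top (at_right 0)" by simp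
      then have "((\<lambda>a. m (\<tau> powr (- 1 / a))) \<longlongrightarrow> m0) (at_right 0)"
        by (rule filterlim_compose[OF m_lim])
      moreover have "((\<lambda>a. ennreal (real DIM('a) + a)) \<longlongrightarrow> ennreal (real DIM('a) + 0)) (at_right 0)"
        by (intro tendsto_ennrealI tendsto_intros)
      moreover have "m0 \<noteq> \<infinity>"
        using m0V V by auto
      ultimately have "((\<lambda>a. ennreal (real DIM('a) + a) * m (\<tau> powr (- 1 / a)))
          \<longlongrightarrow> ennreal (real DIM('a) + 0) * m0) (at_right 0)"
        by (intro tendsto_mult_ennreal) auto
      then show ?thesis using 2 by (simp add: G_def ennreal_of_nat_eq_real_of_nat)
    next
      case 3
      have "((\<lambda>a. \<rho> powr (- a)) \<longlongrightarrow> \<rho> powr (- 0)) (at_right 0)"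
        using \<rho> by (intro tendsto_intros) auto
      then have "eventually (\<lambda>a. \<rho> powr (- a) < \<tau>) (at_right 0)"
        using 3 \<rho> by (intro order_tendstoD(2)) auto
      then have "eventually (\<lambda>a. G a \<tau> = 0) (at_right 0)"
        using eventually_at_right_less[of "0::real"] by eventually_elim (rule Gzero)
      then show ?thesis using 3 by (simp add: tendsto_eventually)
    qed
  qed
  have "((\<lambda>a. \<integral>\<^sup>+\<tau>. G a \<tau> \<partial>lborel) \<longlongrightarrow> (\<integral>\<^sup>+\<tau>. of_nat DIM('a) * m0 * indicator {0<..<1::real} \<tau> \<partial>lborel)) (at_right 0)"
  proof (rule nn_integral_dominated_convergence_at_right[where b=1 and w=W and F=G])
    show "(\<integral>\<^sup>+x. W x \<partial>lborel) < \<infinity>"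
      unfolding W_def using V
      by (subst nn_integral_cmult_indicator) (auto simp: ennreal_mult_less_top)
    show "AE \<tau> in lborel. ((\<lambda>a. G a \<tau>) \<longlongrightarrow> of_nat DIM('a) * m0 * indicator {0<..<1} \<tau>) (at_right 0)"
      using AE_lborel_singleton[of "1::real"] by eventually_elim (rule Glim)
    show "W \<in> borel_measurable lborel" unfolding W_def by measurable
  qed (use Gbound in auto)
  also have "(\<integral>\<^sup>+\<tau>. of_nat DIM('a) * m0 * indicator {0<..<1::real} \<tau> \<partial>lborel) = of_nat DIM('a) * m0"
    by (subst nn_integral_cmult_indicator) auto
  finally have "((\<lambda>a. \<integral>\<^sup>+\<tau>. G a \<tau> \<partial>lborel) \<longlongrightarrow> of_nat DIM('a) * m0) (at_right 0)" .
  moreover have "eventually (\<lambda>a. (\<integral>\<^sup>+\<tau>. G a \<tau> \<partial>lborel) = ennreal a * (\<integral>\<^sup>+z. f z * riesz_kernel a z \<partial>lborel)) (at_right 0)"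
    using eventually_at_right_less[of "0::real"]
    by eventually_elim (simp add: riesz_integral_eq G_def m_def)
  ultimately show ?thesis unfolding m0_def by (rule Lim_transform_eventually)
qed

section \<open>Spherical measure and escape sectors\<close>

lemma nn_integral_sphere_measure:
  fixes f :: "'a::euclidean_space \<Rightarrow> ennreal"
  assumes [measurable]: "f \<in> borel_measurable borel"
  shows "(\<integral>\<^sup>+w. f w \<partial>sphere_measure) = of_nat DIM('a) * (\<integral>\<^sup>+z. f (sgn z) * indicator (ball 0 1) z \<partial>lborel)"
proof -
  note sgn_borel_measurable[measurable]
  have "(\<integral>\<^sup>+w. f w \<partial>sphere_measure)
    = (\<integral>\<^sup>+z. of_nat DIM('a) * indicator (ball 0 1) z * f (sgn z) \<partial>lborel)"
    unfolding sphere_measure_def by (subst nn_integral_distr) (auto simp: nn_integral_density)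
  also have "\<dots> = (\<integral>\<^sup>+z. of_nat DIM('a) * (f (sgn z) * indicator (ball 0 1) z) \<partial>lborel)"
    by (intro nn_integral_cong) (simp add: ac_simps)
  also have "\<dots> = of_nat DIM('a) * (\<integral>\<^sup>+z. f (sgn z) * indicator (ball 0 1) z \<partial>lborel)"
    by (rule nn_integral_cmult) measurable
  finally show ?thesis .
qed

lemma sets_sphere_measure [measurable_cong, simp]: "sets sphere_measure = sets borel"
  by (simp add: sphere_measure_def)

lemma space_sphere_measure [simp]: "space sphere_measure = UNIV"
  by (simp add: sphere_measure_def)

lemma emeasure_sphere_measure_eq:
  fixes A :: "'a::euclidean_space set"
  assumes [measurable]: "A \<in> sets borel"
  shows "emeasure sphere_measure A
    = of_nat DIM('a) * (\<integral>\<^sup>+z. indicator A (sgn z) * indicator (ball 0 1) z \<partial>lborel)"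
  by (subst nn_integral_sphere_measure[symmetric]) auto

lemma finite_measure_sphere_measure: "finite_measure (sphere_measure :: 'a::euclidean_space measure)"
proof (rule finite_measureI)
  have "emeasure sphere_measure (UNIV :: 'a set) = of_nat DIM('a) * emeasure lborel (ball (0::'a) 1)"
    by (subst emeasure_sphere_measure_eq) auto
  then show "emeasure sphere_measure (space sphere_measure :: 'a set) \<noteq> \<infinity>"
    using ball_measure_finite[where 'a='a]
    by (auto simp: ennreal_mult_eq_top_iff)
qed

interpretation sphere_measure: finite_measure sphere_measure
  by (rule finite_measure_sphere_measure)

lemma ennreal_sphere_area: "ennreal (sphere_area A) = emeasure sphere_measure A"
  unfolding sphere_area_def by (rule sphere_measure.emeasure_eq_measure[symmetric])

lemma AE_sphere_measureD:
  fixes P :: "'a::euclidean_space \<Rightarrow> bool"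
  assumes "AE w in sphere_measure. P w"
  shows "AE z in lborel. z \<in> ball 0 1 \<longrightarrow> P (sgn z)"
proof -
  have "AE z in density lborel (\<lambda>x::'a. of_nat DIM('a) * indicator (ball 0 1) x). P (sgn z)"
    using assms unfolding sphere_measure_def
    by (rule AE_distrD[rotated]) (simp add: measurable_cong_sets[of "density _ _" borel] sgn_borel_measurable)
  then show ?thesis by (subst (asm) AE_density) (auto elim!: eventually_mono)
qed

lemma tendsto_indicator_real_iff:
  fixes h :: "'b \<Rightarrow> 'a"
  shows "((\<lambda>r. indicator A (h r) :: real) \<longlongrightarrow> 1) F \<longleftrightarrow> eventually (\<lambda>r. h r \<in> A) F" (is ?one)
    and "((\<lambda>r. indicator A (h r) :: real) \<longlongrightarrow> 0) F \<longleftrightarrow> eventually (\<lambda>r. h r \<notin> A) F" (is ?zero)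
proof -
  show ?one
  proof
    assume "((\<lambda>r. indicator A (h r) :: real) \<longlongrightarrow> 1) F"
    then have "eventually (\<lambda>r. (1/2::real) < indicator A (h r)) F"
      by (rule order_tendstoD) simp
    then show "eventually (\<lambda>r. h r \<in> A) F"
      by eventually_elim (simp split: split_indicator_asm)
  next
    assume "eventually (\<lambda>r. h r \<in> A) F"
    then show "((\<lambda>r. indicator A (h r) :: real) \<longlongrightarrow> 1) F"
      by (intro tendsto_eventually) (auto elim: eventually_mono)
  qed
  show ?zero
  proof
    assume "((\<lambda>r. indicator A (h r) :: real) \<longlongrightarrow> 0) F"
    then have "eventually (\<lambda>r. indicator A (h r) < (1/2::real)) F"
      by (rule order_tendstoD) simp
    then show "eventually (\<lambda>r. h r \<notin> A) F"
      by eventually_elim (simp split: split_indicator_asm)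
  next
    assume "eventually (\<lambda>r. h r \<notin> A) F"
    then show "((\<lambda>r. indicator A (h r) :: real) \<longlongrightarrow> 0) F"
      by (intro tendsto_eventually) (auto elim: eventually_mono)
  qed
qed

text \<open>An indicator along a filter can converge only by being eventually constant.\<close>

lemma tendsto_indicator_realD:
  fixes h :: "'b \<Rightarrow> 'a"
  assumes "((\<lambda>r. indicator A (h r) :: real) \<longlongrightarrow> l) F"
  shows "eventually (\<lambda>r. h r \<in> A) F \<or> eventually (\<lambda>r. h r \<notin> A) F"
proof (cases "l > 1/2")
  case True
  then have "eventually (\<lambda>r. (1/2::real) < indicator A (h r)) F"
    using assms by (intro order_tendstoD)
  then have "eventually (\<lambda>r. h r \<in> A) F"
    by eventually_elim (simp split: split_indicator_asm)
  then show ?thesis ..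
next
  case False
  then have "eventually (\<lambda>r. indicator A (h r) < (1::real)) F"
    using assms by (intro order_tendstoD) auto
  then have "eventually (\<lambda>r. h r \<notin> A) F"
    by eventually_elim (simp split: split_indicator_asm)
  then show ?thesis ..
qed

lemma escape_sector_iff:
  "w \<in> escape_sector \<Omega> x \<longleftrightarrow> norm w = 1 \<and> eventually (\<lambda>r. x + r *\<^sub>R w \<notin> \<Omega>) at_top"
  by (auto simp: escape_sector_def tendsto_indicator_real_iff)

text \<open>Since \<open>- \<Omega>\<close> is closed, this is a countable union of closed sets: the ray
  stays in \<open>- \<Omega>\<close> from some natural number on. Joint measurability makes the
  area of the escape sector a Borel function of the point.\<close>

lemma escape_pairs_borel:
  fixes \<Omega> :: "'a::euclidean_space set"
  assumes "open \<Omega>"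
  shows "{(x, w). w \<in> escape_sector \<Omega> x} \<in> sets (borel \<Otimes>\<^sub>M borel)"
proof -
  have "{(x, w). w \<in> escape_sector \<Omega> x}
     = {p. norm (snd p) = 1} \<inter> (\<Union>n::nat. \<Inter>r\<in>{real n..}. {p. fst p + r *\<^sub>R snd p \<in> - \<Omega>})"
  proof -
    have "eventually (\<lambda>r. P r) at_top \<longleftrightarrow> (\<exists>n::nat. \<forall>r\<ge>real n. P r)" for P
      unfolding eventually_at_top_linorder
      by (meson order_trans real_arch_simple)
    moreover have "(\<forall>r\<in>{real n..}. P r) \<longleftrightarrow> (\<forall>r\<ge>real n. P r)" for n P by auto
    ultimately show ?thesis by (simp add: set_eq_iff escape_sector_iff)
  qed
  moreover have "closed {p. fst p + r *\<^sub>R snd p \<in> - \<Omega>}" for r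
  proof -
    have "closed ((\<lambda>p. fst p + r *\<^sub>R snd p) -` (- \<Omega>))"
      using assms by (intro closed_vimage continuous_intros) auto
    then show ?thesis by (simp add: vimage_def)
  qed
  then have "closed (\<Inter>r\<in>{real n..}. {p. fst p + r *\<^sub>R snd p \<in> - \<Omega>})" for n
    by (intro closed_INT) auto
  moreover have "closed {p::'a \<times> 'a. norm (snd p) = 1}"
    by (intro closed_Collect_eq continuous_intros)
  ultimately show ?thesis
    unfolding borel_prod by (auto intro!: sets.Int sets.countable_UN borel_closed)
qed

lemma escape_sector_borel [measurable]:
  assumes "open \<Omega>"
  shows "escape_sector \<Omega> x \<in> sets borel"
  using sets_Pair1[OF escape_pairs_borel[OF assms], of x] by (simp add: vimage_def)

lemma emeasure_escape_sector_measurable: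
  assumes "open \<Omega>"
  shows "(\<lambda>x. emeasure sphere_measure (escape_sector \<Omega> x)) \<in> borel_measurable borel"
proof -
  have "{(x, w). w \<in> escape_sector \<Omega> x} \<in> sets (borel \<Otimes>\<^sub>M sphere_measure)"
    using escape_pairs_borel[OF assms] by (simp cong: sets_pair_measure_cong)
  from sphere_measure.measurable_emeasure_Pair[OF this] show ?thesis
    by (simp add: vimage_def)
qed

text \<open>The pointwise part of the predicate \<open>radial_limits_exist\<close>.\<close>

definition ray_limits_exist :: "'a::euclidean_space set \<Rightarrow> 'a \<Rightarrow> bool" where
  "ray_limits_exist \<Omega> x \<longleftrightarrow>
     (AE w in sphere_measure. \<exists>l. ((\<lambda>r. indicator (- \<Omega>) (x + r *\<^sub>R w) :: real) \<longlongrightarrow> l) at_top)"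

text \<open>The statement about directions \<open>w\<close> is transported to points \<open>z\<close> of the
  unit ball, along \<open>w = sgn z\<close>; this is the form in which
  \<open>riesz_integral_tendsto\<close> uses it.\<close>

lemma AE_ray_dichotomy:
  fixes x :: "'a::euclidean_space"
  assumes "ray_limits_exist \<Omega> x"
  shows "AE z in lborel. z \<in> ball 0 1 \<longrightarrow> z \<noteq> 0 \<and>
    (if sgn z \<in> escape_sector \<Omega> x then eventually (\<lambda>t. x + t *\<^sub>R z \<notin> \<Omega>) at_top
     else eventually (\<lambda>t. x + t *\<^sub>R z \<in> \<Omega>) at_top)"
  using AE_sphere_measureD[OF assms[unfolded ray_limits_exist_def]] AE_lborel_singleton[of 0]
proof eventually_elim
  case (elim z)
  show ?case
  proof
    assume z: "z \<in> ball 0 1"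
    have scale: "eventually (\<lambda>t. x + t *\<^sub>R z \<in> A) at_top" if "eventually (\<lambda>r. x + r *\<^sub>R sgn z \<in> A) at_top" for A
    proof -
      have "filterlim (\<lambda>t. norm z * t) at_top at_top"
        using elim by (intro filterlim_tendsto_pos_mult_at_top[OF tendsto_const] filterlim_ident) auto
      from eventually_compose_filterlim[OF that this] show ?thesis
        using elim by (simp add: sgn_div_norm field_simps)
    qed
    have n: "norm (sgn z) = 1" using elim by (simp add: norm_sgn)
    obtain l where "((\<lambda>r. indicator (- \<Omega>) (x + r *\<^sub>R sgn z) :: real) \<longlongrightarrow> l) at_top"
      using elim z by auto
    then have "eventually (\<lambda>r. x + r *\<^sub>R sgn z \<in> - \<Omega>) at_top \<or> eventually (\<lambda>r. x + r *\<^sub>R sgn z \<in> \<Omega>) at_top"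
      using tendsto_indicator_realD by fastforce
    then show "z \<noteq> 0 \<and>
    (if sgn z \<in> escape_sector \<Omega> x then eventually (\<lambda>t. x + t *\<^sub>R z \<notin> \<Omega>) at_top
     else eventually (\<lambda>t. x + t *\<^sub>R z \<in> \<Omega>) at_top)"
      using scale[of "- \<Omega>"] scale[of \<Omega>] elim n by (auto simp: escape_sector_iff)
  qed
qed

lemma riesz_integral_shift:
  fixes f :: "'a::euclidean_space \<Rightarrow> ennreal"
  assumes [measurable]: "f \<in> borel_measurable borel"
  shows "(\<integral>\<^sup>+y. f y * riesz_kernel a (x - y) \<partial>lborel) = (\<integral>\<^sup>+z. f (x + z) * riesz_kernel a z \<partial>lborel)"
  by (subst nn_integral_lborel_affine[of _ 1 x]) (auto simp: riesz_kernel_def)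

text \<open>A ball is connected, so it would meet the frontier if it left \<open>\<Omega>\<close>.\<close>

lemma ball_infdist_frontier_subset:
  fixes \<Omega> :: "'a::euclidean_space set"
  assumes "x \<in> \<Omega>" "open \<Omega>" "frontier \<Omega> \<noteq> {}"
  shows "0 < infdist x (frontier \<Omega>)" "ball x (infdist x (frontier \<Omega>)) \<subseteq> \<Omega>"
proof -
  have "x \<notin> frontier \<Omega>" using assms by (simp add: frontier_def interior_open)
  then show "0 < infdist x (frontier \<Omega>)"
    using assms infdist_pos_not_in_closed[of "frontier \<Omega>" x] by auto
  show "ball x (infdist x (frontier \<Omega>)) \<subseteq> \<Omega>"
  proof (rule ccontr)
    assume not: "\<not> ?thesis"
    have "ball x (infdist x (frontier \<Omega>)) \<inter> frontier \<Omega> \<noteq> {}"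
    proof (rule connected_Int_frontier)
      show "ball x (infdist x (frontier \<Omega>)) \<inter> \<Omega> \<noteq> {}"
        using assms(1) \<open>0 < infdist x (frontier \<Omega>)\<close> centre_in_ball by blast
      show "connected (ball x (infdist x (frontier \<Omega>)))" by (rule connected_ball)
      show "ball x (infdist x (frontier \<Omega>)) - \<Omega> \<noteq> {}" using not by blast
    qed
    then obtain y where "y \<in> frontier \<Omega>" "dist x y < infdist x (frontier \<Omega>)" by auto
    then show False using infdist_le[of y "frontier \<Omega>" x] by simp
  qed
qed

lemma riesz_integral_escape_tendsto:
  fixes \<Omega> :: "'a::euclidean_space set"
  assumes \<Omega>: "open \<Omega>" "x \<in> \<Omega>" "ray_limits_exist \<Omega> x"
  shows "((\<lambda>a. ennreal a * (\<integral>\<^sup>+y. indicator (- \<Omega>) y * riesz_kernel a (x - y) \<partial>lborel))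
    \<longlongrightarrow> emeasure sphere_measure (escape_sector \<Omega> x)) (at_right 0)"
proof -
  have [measurable]: "\<Omega> \<in> sets borel" using \<Omega> by simp
  have [measurable]: "escape_sector \<Omega> x \<in> sets borel" using \<Omega> by measurable
  note sgn_borel_measurable[measurable]
  obtain \<rho> where \<rho>: "\<rho> > 0" "ball x \<rho> \<subseteq> \<Omega>" using \<Omega> openE by blast
  have "((\<lambda>a. ennreal a * (\<integral>\<^sup>+z. indicator (- \<Omega>) (x + z) * riesz_kernel a z \<partial>lborel))
    \<longlongrightarrow> of_nat DIM('a) * (\<integral>\<^sup>+z. indicator (escape_sector \<Omega> x) (sgn z) * indicator (ball 0 1) z \<partial>lborel)) (at_right 0)"
  proof (rule riesz_integral_tendsto[where M=1 and \<rho>=\<rho>])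
    show "AE z in lborel. z \<in> ball 0 1 \<longrightarrow>
      ((\<lambda>t. indicator (- \<Omega>) (x + t *\<^sub>R z) :: ennreal) \<longlongrightarrow> indicator (escape_sector \<Omega> x) (sgn z)) at_top"
      using AE_ray_dichotomy[OF \<Omega>(3)]
    proof (eventually_elim, intro impI)
      fix z assume "z \<in> ball 0 1 \<longrightarrow> z \<noteq> 0 \<and>
    (if sgn z \<in> escape_sector \<Omega> x then eventually (\<lambda>t. x + t *\<^sub>R z \<notin> \<Omega>) at_top
     else eventually (\<lambda>t. x + t *\<^sub>R z \<in> \<Omega>) at_top)" "z \<in> ball 0 1"
      then show "((\<lambda>t. indicator (- \<Omega>) (x + t *\<^sub>R z) :: ennreal) \<longlongrightarrow> indicator (escape_sector \<Omega> x) (sgn z)) at_top"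
        by (intro tendsto_eventually) (auto elim: eventually_mono split: if_splits)
    qed
    show "indicator (- \<Omega>) (x + z) = (0::ennreal)" if "norm z < \<rho>" for z
      using that \<rho>(2) by (auto simp: indicator_def dist_norm)
  qed (use \<rho> in \<open>auto simp: indicator_def\<close>)
  then show ?thesis by (simp add: riesz_integral_shift emeasure_sphere_measure_eq)
qed

text \<open>The singularity at the origin is cut off. What remains is integrable, and \<open>a\<close> times
  its integral stays bounded as \<open>a\<close> tends to 0, uniformly over all translates of
  \<open>\<Omega>\<close>.\<close>

definition far_kernel :: "real \<Rightarrow> 'a::euclidean_space \<Rightarrow> ennreal" where
  "far_kernel a z = indicator (- ball 0 1) z * riesz_kernel a z"

lemma far_kernel_measurable [measurable]: "far_kernel a \<in> borel_measurable borel"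
  unfolding far_kernel_def by measurable

lemma far_kernel_minus: "far_kernel a (- z) = far_kernel a z"
  by (simp add: far_kernel_def riesz_kernel_def indicator_def)

lemma far_integral_shift:
  fixes f :: "'a::euclidean_space \<Rightarrow> ennreal"
  assumes [measurable]: "f \<in> borel_measurable borel"
  shows "(\<integral>\<^sup>+y. f y * far_kernel a (x - y) \<partial>lborel)
    = (\<integral>\<^sup>+z. f (x + z) * indicator (- ball 0 1) z * riesz_kernel a z \<partial>lborel)"
  by (subst nn_integral_lborel_affine[of _ 1 x]) (auto simp: far_kernel_minus, simp add: far_kernel_def mult.assoc)

text \<open>Every \<open>z \<noteq> 0\<close> leaves the cut-off ball when it is scaled up, so the cut-off
  has no influence on the limit, which is the area of the directions that stay in
  \<open>\<Omega>\<close>.\<close>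

lemma far_integral_remain_tendsto:
  fixes \<Omega> :: "'a::euclidean_space set"
  assumes \<Omega>: "open \<Omega>" "ray_limits_exist \<Omega> x"
  shows "((\<lambda>a. ennreal a * (\<integral>\<^sup>+y. indicator \<Omega> y * far_kernel a (x - y) \<partial>lborel))
    \<longlongrightarrow> emeasure sphere_measure (sphere 0 1 - escape_sector \<Omega> x)) (at_right 0)"
proof -
  have [measurable]: "\<Omega> \<in> sets borel" using \<Omega> by simp
  have [measurable]: "escape_sector \<Omega> x \<in> sets borel" using \<Omega> by measurable
  note sgn_borel_measurable[measurable]
  let ?f = "\<lambda>z. indicator \<Omega> (x + z) * indicator (- ball 0 1) z :: ennreal"
  have "((\<lambda>a. ennreal a * (\<integral>\<^sup>+z. ?f z * riesz_kernel a z \<partial>lborel))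
    \<longlongrightarrow> of_nat DIM('a) * (\<integral>\<^sup>+z. indicator (sphere 0 1 - escape_sector \<Omega> x) (sgn z) * indicator (ball 0 1) z \<partial>lborel)) (at_right 0)"
  proof (rule riesz_integral_tendsto[where M=1 and \<rho>=1])
    show "AE z in lborel. z \<in> ball 0 1 \<longrightarrow>
      ((\<lambda>t. ?f (t *\<^sub>R z)) \<longlongrightarrow> indicator (sphere 0 1 - escape_sector \<Omega> x) (sgn z)) at_top"
      using AE_ray_dichotomy[OF \<Omega>(2)]
    proof (eventually_elim, intro impI)
      fix z assume z: "z \<in> ball 0 1 \<longrightarrow> z \<noteq> 0 \<and>
    (if sgn z \<in> escape_sector \<Omega> x then eventually (\<lambda>t. x + t *\<^sub>R z \<notin> \<Omega>) at_top
     else eventually (\<lambda>t. x + t *\<^sub>R z \<in> \<Omega>) at_top)" "z \<in> ball 0 1"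
      then have sz: "norm (sgn z) = 1" by (auto simp: norm_sgn)
      have far: "eventually (\<lambda>t. t *\<^sub>R z \<notin> ball 0 1) at_top"
        using eventually_ge_at_top[of "1 / norm z"]
      proof eventually_elim
        case (elim t)
        then have "1 \<le> t * norm z" using z by (auto simp: field_simps)
        also have "\<dots> \<le> \<bar>t\<bar> * norm z" by (intro mult_right_mono) auto
        finally show ?case by simp
      qed
      show "((\<lambda>t. ?f (t *\<^sub>R z)) \<longlongrightarrow> indicator (sphere 0 1 - escape_sector \<Omega> x) (sgn z)) at_top"
      proof (cases "sgn z \<in> escape_sector \<Omega> x")
        case True
        then have "eventually (\<lambda>t. x + t *\<^sub>R z \<notin> \<Omega>) at_top" using z by simp
        then have "eventually (\<lambda>t. ?f (t *\<^sub>R z) = indicator (sphere 0 1 - escape_sector \<Omega> x) (sgn z)) at_top"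
          by eventually_elim (simp add: True)
        then show ?thesis by (rule tendsto_eventually)
      next
        case False
        then have "eventually (\<lambda>t. x + t *\<^sub>R z \<in> \<Omega>) at_top" using z by simp
        with far have "eventually (\<lambda>t. ?f (t *\<^sub>R z) = indicator (sphere 0 1 - escape_sector \<Omega> x) (sgn z)) at_top"
          by eventually_elim (simp add: False sz)
        then show ?thesis by (rule tendsto_eventually)
      qed
    qed
  qed (auto simp: indicator_def)
  then show ?thesis by (simp add: far_integral_shift emeasure_sphere_measure_eq)
qed

section \<open>The escape integrals averaged over the domain\<close>

lemma boundary_weight_measurable [measurable]:
  "boundary_weight \<Omega> t \<in> borel_measurable borel"
proof -
  have [measurable]: "(\<lambda>x. infdist x (frontier \<Omega>)) \<in> borel_measurable borel"
    by (intro borel_measurable_continuous_onI continuous_intros)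
  show ?thesis unfolding boundary_weight_def[abs_def] by measurable
qed

text \<open>The complement of \<open>\<Omega>\<close> has distance at least \<open>\<delta>\<close> from
  \<open>x\<close>, which bounds the integral by a multiple of \<open>\<delta> powr (- a)\<close>.
  This is at most \<open>1 + \<delta> powr (- b)\<close> whenever \<open>0 < a \<le> b\<close>, a
  majorant independent of \<open>a\<close>.\<close>

lemma escape_integral_le:
  fixes \<Omega> :: "'a::euclidean_space set"
  assumes \<Omega>: "open \<Omega>" "x \<in> \<Omega>" and a: "0 < a" "a < 1" "a \<le> b"
  shows "ennreal a * (\<integral>\<^sup>+y. indicator (- \<Omega>) y * riesz_kernel a (x - y) \<partial>lborel)
    \<le> ennreal (real DIM('a) + 1) * emeasure lborel (ball (0::'a) 1) * (1 + ennreal (boundary_weight \<Omega> b x))"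
proof (cases "frontier \<Omega> = {}")
  case True
  then have "\<Omega> = UNIV" using \<Omega> frontier_eq_empty by auto
  then show ?thesis by simp
next
  case False
  have [measurable]: "\<Omega> \<in> sets borel" using \<Omega> by simp
  define \<delta> where "\<delta> = infdist x (frontier \<Omega>)"
  have \<delta>: "\<delta> > 0" "ball x \<delta> \<subseteq> \<Omega>"
    using ball_infdist_frontier_subset[OF \<Omega>(2,1) False] by (auto simp: \<delta>_def)
  have "ennreal a * (\<integral>\<^sup>+z. indicator (- \<Omega>) (x + z) * riesz_kernel a z \<partial>lborel)
     \<le> ennreal (real DIM('a) + a) * 1 * emeasure lborel (ball (0::'a) 1) * ennreal (\<delta> powr (- a))"
  proof (rule riesz_integral_le)
    show "indicator (- \<Omega>) (x + z) = (0::ennreal)" if "norm z < \<delta>" for z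
      using that \<delta>(2) by (auto simp: indicator_def dist_norm)
  qed (use \<delta> a in \<open>auto simp: indicator_def\<close>)
  also have "\<dots> \<le> ennreal (real DIM('a) + 1) * emeasure lborel (ball (0::'a) 1) * (1 + ennreal (boundary_weight \<Omega> b x))"
  proof -
    have "\<delta> powr (- a) \<le> 1 + \<delta> powr (- b)"
    proof (cases "\<delta> \<ge> 1")
      case True
      then have "\<delta> powr (- a) \<le> \<delta> powr 0" using a by (intro powr_mono) auto
      then show ?thesis using \<delta> by (simp add: add_increasing2)
    next
      case False
      then have "\<delta> powr (- a) \<le> \<delta> powr (- b)" using a \<delta> by (intro powr_mono') auto
      then show ?thesis by simp
    qed
    then have "ennreal (\<delta> powr (- a)) \<le> 1 + ennreal (boundary_weight \<Omega> b x)"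
      using False by (simp add: boundary_weight_def \<delta>_def flip: ennreal_1 ennreal_plus)
    then show ?thesis using a by (auto intro!: mult_mono ennreal_leI)
  qed
  finally show ?thesis by (simp add: riesz_integral_shift)
qed

lemma weighted_escape_integral_tendsto:
  fixes \<Omega> :: "'a::euclidean_space set" and q :: "'a \<Rightarrow> ennreal"
  assumes \<Omega>: "open \<Omega>" and rays: "AE x in lborel. x \<in> \<Omega> \<longrightarrow> ray_limits_exist \<Omega> x"
    and q[measurable]: "q \<in> borel_measurable borel" and off: "\<And>x. x \<notin> \<Omega> \<Longrightarrow> q x = 0"
    and fin: "(\<integral>\<^sup>+x. q x \<partial>lborel) < \<infinity>"
    and b: "0 < b" and wfin: "(\<integral>\<^sup>+x. q x * ennreal (boundary_weight \<Omega> b x) \<partial>lborel) < \<infinity>"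
  shows "((\<lambda>a. \<integral>\<^sup>+x. q x * (ennreal a * (\<integral>\<^sup>+y. indicator (- \<Omega>) y * riesz_kernel a (x - y) \<partial>lborel)) \<partial>lborel)
    \<longlongrightarrow> (\<integral>\<^sup>+x. q x * emeasure sphere_measure (escape_sector \<Omega> x) \<partial>lborel)) (at_right 0)"
proof -
  have [measurable]: "\<Omega> \<in> sets borel" using \<Omega> by simp
  note emeasure_escape_sector_measurable[OF \<Omega>, measurable]
  have q_finite: "AE x in lborel. q x \<noteq> \<infinity>"
    using fin by (intro nn_integral_PInf_AE) auto
  define C where "C = ennreal (real DIM('a) + 1) * emeasure lborel (ball (0::'a) 1)"
  have C: "C < \<infinity>" using ball_measure_finite[where 'a='a] by (auto simp: C_def ennreal_mult_less_top)
  define w where "w x = C * (q x + q x * ennreal (boundary_weight \<Omega> b x))" for x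
  show ?thesis
  proof (rule nn_integral_dominated_convergence_at_right[where b="min 1 b" and w=w])
    show "0 < min 1 b" using b by simp
    show "(\<lambda>x. q x * (ennreal s * (\<integral>\<^sup>+y. indicator (- \<Omega>) y * riesz_kernel s (x - y) \<partial>lborel))) \<in> borel_measurable lborel" for s
      by measurable
    show "(\<lambda>x. q x * emeasure sphere_measure (escape_sector \<Omega> x)) \<in> borel_measurable lborel"
      by measurable
    show "w \<in> borel_measurable lborel"
      unfolding w_def by measurable
    show "(\<integral>\<^sup>+x. w x \<partial>lborel) < \<infinity>"
      unfolding w_def using fin wfin C
      by (subst nn_integral_cmult) (auto simp: nn_integral_add ennreal_mult_less_top)
    show "AE x in lborel. q x * (ennreal s * (\<integral>\<^sup>+y. indicator (- \<Omega>) y * riesz_kernel s (x - y) \<partial>lborel)) \<le> w x"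
      if "0 < s" "s < min 1 b" for s
    proof (rule AE_I2)
      fix x
      show "q x * (ennreal s * (\<integral>\<^sup>+y. indicator (- \<Omega>) y * riesz_kernel s (x - y) \<partial>lborel)) \<le> w x"
      proof (cases "x \<in> \<Omega>")
        case True
        have "q x * (ennreal s * (\<integral>\<^sup>+y. indicator (- \<Omega>) y * riesz_kernel s (x - y) \<partial>lborel))
          \<le> q x * (C * (1 + ennreal (boundary_weight \<Omega> b x)))"
          unfolding C_def using that by (intro mult_left_mono escape_integral_le \<Omega> True) auto
        also have "\<dots> = w x" by (simp add: w_def distrib_left ac_simps)
        finally show ?thesis .
      qed (simp add: off)
    qed
    show "AE x in lborel. ((\<lambda>s. q x * (ennreal s * (\<integral>\<^sup>+y. indicator (- \<Omega>) y * riesz_kernel s (x - y) \<partial>lborel)))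
       \<longlongrightarrow> q x * emeasure sphere_measure (escape_sector \<Omega> x)) (at_right 0)"
      using rays q_finite
    proof (eventually_elim)
      fix x assume x: "x \<in> \<Omega> \<longrightarrow> ray_limits_exist \<Omega> x" "q x \<noteq> \<infinity>"
      show "((\<lambda>s. q x * (ennreal s * (\<integral>\<^sup>+y. indicator (- \<Omega>) y * riesz_kernel s (x - y) \<partial>lborel)))
       \<longlongrightarrow> q x * emeasure sphere_measure (escape_sector \<Omega> x)) (at_right 0)"
      proof (cases "x \<in> \<Omega>")
        case True
        then show ?thesis using x
          by (intro tendsto_mult_ennreal tendsto_const riesz_integral_escape_tendsto \<Omega>) (auto simp: sphere_measure.emeasure_finite)
      qed (simp add: off)
    qed
  qed
qed

lemma weighted_remain_integral_tendsto:
  fixes \<Omega> :: "'a::euclidean_space set" and q :: "'a \<Rightarrow> ennreal"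
  assumes \<Omega>: "open \<Omega>" and rays: "AE x in lborel. x \<in> \<Omega> \<longrightarrow> ray_limits_exist \<Omega> x"
    and q[measurable]: "q \<in> borel_measurable borel" and off: "\<And>x. x \<notin> \<Omega> \<Longrightarrow> q x = 0"
    and fin: "(\<integral>\<^sup>+x. q x \<partial>lborel) < \<infinity>"
  shows "((\<lambda>a. \<integral>\<^sup>+x. q x * (ennreal a * (\<integral>\<^sup>+y. indicator \<Omega> y * far_kernel a (x - y) \<partial>lborel)) \<partial>lborel)
    \<longlongrightarrow> (\<integral>\<^sup>+x. q x * emeasure sphere_measure (sphere 0 1 - escape_sector \<Omega> x) \<partial>lborel)) (at_right 0)"
proof -
  have [measurable]: "\<Omega> \<in> sets borel" using \<Omega> by simp
  note emeasure_escape_sector_measurable[OF \<Omega>, measurable]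
  have q_finite: "AE x in lborel. q x \<noteq> \<infinity>"
    using fin by (intro nn_integral_PInf_AE) auto
  define C where "C = ennreal (real DIM('a) + 1) * emeasure lborel (ball (0::'a) 1)"
  have C: "C < \<infinity>" using ball_measure_finite[where 'a='a] by (auto simp: C_def ennreal_mult_less_top)
  have remain: "emeasure sphere_measure (sphere 0 1 - escape_sector \<Omega> x)
     = emeasure sphere_measure (sphere (0::'a) 1) - emeasure sphere_measure (escape_sector \<Omega> x)" for x
    using escape_sector_borel[OF \<Omega>, of x] sphere_measure.emeasure_finite
    by (intro emeasure_Diff) (auto simp: escape_sector_iff)
  have bound: "ennreal s * (\<integral>\<^sup>+y. indicator \<Omega> y * far_kernel s (x - y) \<partial>lborel) \<le> C" if "0 < s" "s < 1" for s x
  proof -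
    have "ennreal s * (\<integral>\<^sup>+z. indicator \<Omega> (x + z) * indicator (- ball 0 1) z * riesz_kernel s z \<partial>lborel)
       \<le> ennreal (real DIM('a) + s) * 1 * emeasure lborel (ball (0::'a) 1) * ennreal (1 powr (- s))"
      using that by (intro riesz_integral_le) (auto simp: indicator_def)
    also have "\<dots> \<le> C" unfolding C_def using that by (auto intro!: mult_right_mono ennreal_leI)
    finally show ?thesis by (simp add: far_integral_shift)
  qed
  show ?thesis
  proof (rule nn_integral_dominated_convergence_at_right[where b=1 and w="\<lambda>x. q x * C"])
    show "(\<lambda>x. q x * (ennreal s * (\<integral>\<^sup>+y. indicator \<Omega> y * far_kernel s (x - y) \<partial>lborel))) \<in> borel_measurable lborel" for s
      by measurable
    show "(\<lambda>x. q x * emeasure sphere_measure (sphere 0 1 - escape_sector \<Omega> x)) \<in> borel_measurable lborel"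
      unfolding remain by measurable
    show "(\<lambda>x. q x * C) \<in> borel_measurable lborel" by measurable
    show "(\<integral>\<^sup>+x. q x * C \<partial>lborel) < \<infinity>"
      using fin C by (simp add: nn_integral_multc ennreal_mult_less_top)
    show "AE x in lborel. q x * (ennreal s * (\<integral>\<^sup>+y. indicator \<Omega> y * far_kernel s (x - y) \<partial>lborel)) \<le> q x * C"
      if "0 < s" "s < 1" for s
      using bound[OF that] by (intro AE_I2 mult_left_mono) auto
    show "AE x in lborel. ((\<lambda>s. q x * (ennreal s * (\<integral>\<^sup>+y. indicator \<Omega> y * far_kernel s (x - y) \<partial>lborel)))
       \<longlongrightarrow> q x * emeasure sphere_measure (sphere 0 1 - escape_sector \<Omega> x)) (at_right 0)"
      using rays q_finite
    proof (eventually_elim)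
      fix x assume x: "x \<in> \<Omega> \<longrightarrow> ray_limits_exist \<Omega> x" "q x \<noteq> \<infinity>"
      show "((\<lambda>s. q x * (ennreal s * (\<integral>\<^sup>+y. indicator \<Omega> y * far_kernel s (x - y) \<partial>lborel)))
       \<longlongrightarrow> q x * emeasure sphere_measure (sphere 0 1 - escape_sector \<Omega> x)) (at_right 0)"
      proof (cases "x \<in> \<Omega>")
        case True
        then show ?thesis using x
          by (intro tendsto_mult_ennreal tendsto_const far_integral_remain_tendsto \<Omega>) (auto simp: sphere_measure.emeasure_finite)
      qed (simp add: off)
    qed
  qed simp
qed

section \<open>Power differences of far translates\<close>

text \<open>For \<open>\<bar>t\<bar>\<close> small relative to \<open>\<bar>s\<bar>\<close>, continuity of
  \<open>\<tau> \<mapsto> \<bar>1 - \<tau>\<bar> powr p\<close> at 0 controls \<open>\<bar>s -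
  t\<bar> powr p - \<bar>s\<bar> powr p\<close> by \<open>\<epsilon> * \<bar>s\<bar> powr
  p\<close>; otherwise \<open>\<bar>s\<bar>\<close> is bounded by a multiple of
  \<open>\<bar>t\<bar>\<close>, and everything is absorbed into \<open>C\<close>.\<close>

lemma powr_diff_defect:
  fixes p \<epsilon> :: real
  assumes p: "p > 0" and \<epsilon>: "\<epsilon> > 0"
  obtains C where "C \<ge> 0"
    "\<And>s t. \<bar>\<bar>s - t\<bar> powr p - \<bar>s\<bar> powr p - \<bar>t\<bar> powr p\<bar> \<le> \<epsilon> * \<bar>s\<bar> powr p + C * \<bar>t\<bar> powr p"
proof -
  \<comment> \<open>The variable \<open>\<tau>\<close> stands for the ratio \<open>t / s\<close>.\<close>
  have "isCont (\<lambda>\<tau>::real. \<bar>1 - \<tau>\<bar> powr p) 0"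
    by (intro continuous_intros) auto
  then obtain \<delta> where \<delta>: "\<delta> > 0" "\<And>\<tau>. \<bar>\<tau>\<bar> < \<delta> \<Longrightarrow> \<bar>\<bar>1 - \<tau>\<bar> powr p - 1\<bar> < \<epsilon>"
    using \<epsilon> unfolding continuous_at_eps_delta by (auto simp: dist_real_def)
  define C where "C = (1 / \<delta> + 1) powr p + (1 / \<delta>) powr p + 1"
  have C: "C \<ge> 1" by (simp add: C_def)
  have "\<bar>\<bar>s - t\<bar> powr p - \<bar>s\<bar> powr p - \<bar>t\<bar> powr p\<bar> \<le> \<epsilon> * \<bar>s\<bar> powr p + C * \<bar>t\<bar> powr p" for s t :: real
  proof (cases "\<bar>t\<bar> < \<delta> * \<bar>s\<bar>")
    case True
    then have s: "s \<noteq> 0" by auto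
    have "\<bar>t / s\<bar> < \<delta>" using True s by (simp add: field_simps)
    then have *: "\<bar>\<bar>1 - t / s\<bar> powr p - 1\<bar> < \<epsilon>" by (rule \<delta>(2))
    have "\<bar>s - t\<bar> = \<bar>s\<bar> * \<bar>1 - t / s\<bar>" using s by (simp add: field_simps flip: abs_mult)
    then have "\<bar>s - t\<bar> powr p - \<bar>s\<bar> powr p = \<bar>s\<bar> powr p * (\<bar>1 - t / s\<bar> powr p - 1)"
      by (simp add: powr_mult algebra_simps)
    then have "\<bar>\<bar>s - t\<bar> powr p - \<bar>s\<bar> powr p\<bar> = \<bar>s\<bar> powr p * \<bar>\<bar>1 - t / s\<bar> powr p - 1\<bar>"
      by (simp add: abs_mult)
    also have "\<dots> \<le> \<bar>s\<bar> powr p * \<epsilon>" using * by (intro mult_left_mono) auto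
    finally have "\<bar>\<bar>s - t\<bar> powr p - \<bar>s\<bar> powr p\<bar> \<le> \<epsilon> * \<bar>s\<bar> powr p" by (simp add: mult.commute)
    moreover have "1 * \<bar>t\<bar> powr p \<le> C * \<bar>t\<bar> powr p" using C by (intro mult_right_mono) auto
    moreover have "0 \<le> \<bar>t\<bar> powr p" by simp
    moreover have "\<bar>A - S - T\<bar> \<le> E + CT" if "\<bar>A - S\<bar> \<le> E" "1 * T \<le> CT" "0 \<le> T" for A S T E CT :: real
      using that by linarith
    ultimately show ?thesis by blast
  next
    case False
    then have le: "\<bar>s\<bar> \<le> (1 / \<delta>) * \<bar>t\<bar>" using \<delta> by (simp add: field_simps)
    have 1: "\<bar>s\<bar> powr p \<le> (1 / \<delta>) powr p * \<bar>t\<bar> powr p"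
    proof -
      have "\<bar>s\<bar> powr p \<le> ((1 / \<delta>) * \<bar>t\<bar>) powr p" using le p by (intro powr_mono2) auto
      also have "\<dots> = (1 / \<delta>) powr p * \<bar>t\<bar> powr p" using \<delta> by (subst powr_mult) auto
      finally show ?thesis .
    qed
    have "\<bar>s - t\<bar> \<le> (1 / \<delta> + 1) * \<bar>t\<bar>" using le by (simp add: algebra_simps)
    then have 2: "\<bar>s - t\<bar> powr p \<le> (1 / \<delta> + 1) powr p * \<bar>t\<bar> powr p"
      using powr_mono2[of p "\<bar>s - t\<bar>" "(1 / \<delta> + 1) * \<bar>t\<bar>"] p \<delta> by (simp add: powr_mult)
    have "\<bar>\<bar>s - t\<bar> powr p - \<bar>s\<bar> powr p - \<bar>t\<bar> powr p\<bar> \<le> \<bar>s - t\<bar> powr p + \<bar>s\<bar> powr p + \<bar>t\<bar> powr p"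
    proof -
      have "\<bar>A - S - T\<bar> \<le> A + S + T" if "0 \<le> A" "0 \<le> S" "0 \<le> T" for A S T :: real
        using that by linarith
      then show ?thesis by simp
    qed
    also have "\<dots> \<le> C * \<bar>t\<bar> powr p" using 1 2 by (simp add: C_def algebra_simps)
    also have "\<dots> \<le> \<epsilon> * \<bar>s\<bar> powr p + C * \<bar>t\<bar> powr p" using \<epsilon> by simp
    finally show ?thesis .
  qed
  then show ?thesis using that[of C] C by simp
qed


definition power_defect :: "real \<Rightarrow> real \<Rightarrow> real \<Rightarrow> ennreal" where
  "power_defect p s t = ennreal \<bar>\<bar>s - t\<bar> powr p - \<bar>s\<bar> powr p - \<bar>t\<bar> powr p\<bar>"

lemma power_defect_measurable [measurable (raw)]:
  assumes [measurable]: "f \<in> borel_measurable M" "g \<in> borel_measurable M"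
  shows "(\<lambda>x. power_defect p (f x) (g x)) \<in> borel_measurable M"
  unfolding power_defect_def by measurable

lemma power_defect_commute: "power_defect p s t = power_defect p t s"
  unfolding power_defect_def by (simp add: abs_minus_commute) (smt (verit))

lemma power_defect_le:
  assumes "p > 0" "\<epsilon> > 0"
  obtains C where "C \<ge> 0"
    "\<And>s t. power_defect p s t \<le> ennreal \<epsilon> * ennreal (\<bar>s\<bar> powr p) + ennreal C * ennreal (\<bar>t\<bar> powr p)"
proof -
  obtain C where C: "C \<ge> 0"
    "\<And>s t. \<bar>\<bar>s - t\<bar> powr p - \<bar>s\<bar> powr p - \<bar>t\<bar> powr p\<bar> \<le> \<epsilon> * \<bar>s\<bar> powr p + C * \<bar>t\<bar> powr p"
    using powr_diff_defect[OF assms] by blast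
  have "power_defect p s t \<le> ennreal (\<epsilon> * \<bar>s\<bar> powr p + C * \<bar>t\<bar> powr p)" for s t
    unfolding power_defect_def by (intro ennreal_leI C)
  then show ?thesis
    using that[of C] C(1) assms by (simp add: ennreal_mult)
qed

lemma nn_integral_translate:
  fixes f :: "'a::euclidean_space \<Rightarrow> ennreal"
  assumes "f \<in> borel_measurable borel"
  shows "(\<integral>\<^sup>+x. f (x + z) \<partial>lborel) = (\<integral>\<^sup>+x. f x \<partial>lborel)"
  using nn_integral_lborel_affine[OF assms, of 1 z] by (simp add: add.commute)

lemma power_defect_integral_bounded:
  fixes v :: "'a::euclidean_space \<Rightarrow> real"
  assumes [measurable]: "v \<in> borel_measurable borel" and p: "p > 0"
    and fin: "(\<integral>\<^sup>+x. ennreal (\<bar>v x\<bar> powr p) \<partial>lborel) < \<infinity>"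
  obtains K where "K < \<infinity>" "\<And>z. (\<integral>\<^sup>+x. power_defect p (v x) (v (x + z)) \<partial>lborel) \<le> K"
proof -
  define q where "q x = ennreal (\<bar>v x\<bar> powr p)" for x
  have [measurable]: "q \<in> borel_measurable borel" unfolding q_def by measurable
  obtain C where "C \<ge> 0" and C: "\<And>s t. power_defect p s t \<le> ennreal 1 * ennreal (\<bar>s\<bar> powr p) + ennreal C * ennreal (\<bar>t\<bar> powr p)"
    using power_defect_le[OF p zero_less_one] by blast
  have "(\<integral>\<^sup>+x. power_defect p (v x) (v (x + z)) \<partial>lborel) \<le> (\<integral>\<^sup>+x. q x \<partial>lborel) + ennreal C * (\<integral>\<^sup>+x. q x \<partial>lborel)" for z
  proof -
    have "(\<integral>\<^sup>+x. power_defect p (v x) (v (x + z)) \<partial>lborel) \<le> (\<integral>\<^sup>+x. q x + ennreal C * q (x + z) \<partial>lborel)"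
      using C by (intro nn_integral_mono) (simp add: q_def)
    also have "\<dots> = (\<integral>\<^sup>+x. q x \<partial>lborel) + ennreal C * (\<integral>\<^sup>+x. q x \<partial>lborel)"
      by (simp add: nn_integral_add nn_integral_cmult nn_integral_translate)
    finally show ?thesis .
  qed
  moreover have "(\<integral>\<^sup>+x. q x \<partial>lborel) + ennreal C * (\<integral>\<^sup>+x. q x \<partial>lborel) < \<infinity>"
    using fin by (auto simp: q_def ennreal_mult_less_top)
  ultimately show ?thesis using that by blast
qed

text \<open>If \<open>norm y \<ge> 2 * n\<close>, then \<open>x\<close> or \<open>x + y\<close> lies outside
  the ball of radius \<open>n\<close>, so one of the two values of \<open>v\<close> belongs to the
  tail. Giving the tail value the large constant \<open>C\<close> and the other one the small
  constant \<open>\<epsilon>\<close> makes the integral small: first \<open>\<epsilon>\<close> is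
  chosen, then \<open>n\<close>.\<close>

lemma power_defect_integral_tendsto_0:
  fixes v :: "'a::euclidean_space \<Rightarrow> real"
  assumes [measurable]: "v \<in> borel_measurable borel" and p: "p > 0"
    and fin: "(\<integral>\<^sup>+x. ennreal (\<bar>v x\<bar> powr p) \<partial>lborel) < \<infinity>" and z: "z \<noteq> 0"
  shows "((\<lambda>t. \<integral>\<^sup>+x. power_defect p (v x) (v (x + t *\<^sub>R z)) \<partial>lborel) \<longlongrightarrow> 0) at_top"
proof (rule order_tendstoI)
  fix a :: ennreal assume a: "0 < a"
  define q where "q x = ennreal (\<bar>v x\<bar> powr p)" for x
  have [measurable]: "q \<in> borel_measurable borel" unfolding q_def by measurable
  define I where "I = (\<integral>\<^sup>+x. q x \<partial>lborel)"
  have I: "I < \<infinity>" using fin by (simp add: I_def q_def)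
  have "((\<lambda>\<epsilon>. ennreal (2 * \<epsilon>) * I) \<longlongrightarrow> ennreal (2 * 0) * I) (at_right 0)"
    using I by (intro tendsto_mult_ennreal tendsto_ennrealI tendsto_intros) auto
  then have "eventually (\<lambda>\<epsilon>. ennreal (2 * \<epsilon>) * I < a) (at_right 0)"
    using a by (intro order_tendstoD(2)[where y="ennreal (2 * 0) * I"]) auto
  then have "eventually (\<lambda>\<epsilon>. ennreal (2 * \<epsilon>) * I < a \<and> 0 < \<epsilon>) (at_right 0)"
    using eventually_at_right_less[of "0::real"] by (rule eventually_conj)
  then obtain \<epsilon> where \<epsilon>: "ennreal (2 * \<epsilon>) * I < a" "0 < \<epsilon>"
    using eventually_happens'[OF trivial_limit_at_right_real] by blast
  obtain C where C: "C \<ge> 0" "\<And>s t. power_defect p s t \<le> ennreal \<epsilon> * ennreal (\<bar>s\<bar> powr p) + ennreal C * ennreal (\<bar>t\<bar> powr p)"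
    using power_defect_le[OF p \<epsilon>(2)] by blast
  define tail where "tail n x = q x * indicator (- ball 0 (real n)) x" for n x
  have [measurable]: "tail n \<in> borel_measurable borel" for n unfolding tail_def by measurable
  have "(\<lambda>n. \<integral>\<^sup>+x. tail n x \<partial>lborel) \<longlonglongrightarrow> (\<integral>\<^sup>+x. 0 \<partial>(lborel :: 'a measure))"
  proof (rule nn_integral_dominated_convergence[where w=q])
    show "AE x in lborel. (\<lambda>n. tail n x) \<longlonglongrightarrow> 0"
    proof (rule AE_I2)
      fix x :: 'a
      have "eventually (\<lambda>n. norm x < real n) sequentially"
        by (rule eventually_compose_filterlim[OF eventually_gt_at_top filterlim_real_sequentially])
      then have "eventually (\<lambda>n. tail n x = 0) sequentially"
        by eventually_elim (simp add: tail_def)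
      then show "(\<lambda>n. tail n x) \<longlonglongrightarrow> 0" by (rule tendsto_eventually)
    qed
    show "AE x in lborel. tail n x \<le> q x" for n
      by (intro AE_I2) (simp add: tail_def indicator_def)
  qed (use I in \<open>auto simp: I_def\<close>)
  then have "(\<lambda>n. ennreal (2 * \<epsilon>) * I + ennreal (2 * C) * (\<integral>\<^sup>+x. tail n x \<partial>lborel))
     \<longlonglongrightarrow> ennreal (2 * \<epsilon>) * I + ennreal (2 * C) * 0"
    by (intro tendsto_add tendsto_const tendsto_mult_ennreal) auto
  then have "eventually (\<lambda>n. ennreal (2 * \<epsilon>) * I + ennreal (2 * C) * (\<integral>\<^sup>+x. tail n x \<partial>lborel) < a) sequentially"
    using \<epsilon>(1) by (intro order_tendstoD(2)) auto
  then obtain n where n: "ennreal (2 * \<epsilon>) * I + ennreal (2 * C) * (\<integral>\<^sup>+x. tail n x \<partial>lborel) < a"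
    using eventually_happens'[OF sequentially_bot] by blast
  \<comment> \<open>One of \<open>x\<close> and \<open>x + y\<close> is far from the origin, and its value is charged with the constant \<open>C\<close>.\<close>
  have bound: "(\<integral>\<^sup>+x. power_defect p (v x) (v (x + y)) \<partial>lborel) < a" if y: "norm y \<ge> 2 * real n" for y
  proof -
    have pt: "power_defect p (v x) (v (x + y))
       \<le> (ennreal \<epsilon> * q x + ennreal \<epsilon> * q (x + y)) + (ennreal C * tail n x + ennreal C * tail n (x + y))" for x
    proof (cases "norm x \<ge> real n")
      case True
      have "power_defect p (v x) (v (x + y)) \<le> ennreal \<epsilon> * q (x + y) + ennreal C * q x"
        unfolding q_def by (subst power_defect_commute) (rule C)
      also have "q x = tail n x" using True by (simp add: tail_def)
      also have "ennreal \<epsilon> * q (x + y) + ennreal C * tail n x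
        \<le> (ennreal \<epsilon> * q x + ennreal \<epsilon> * q (x + y)) + (ennreal C * tail n x + ennreal C * tail n (x + y))"
        by (intro add_mono) (simp_all add: add_increasing add_increasing2)
      finally show ?thesis .
    next
      case False
      have "norm y \<le> norm (x + y) + norm x" using norm_triangle_ineq4[of "x + y" x] by simp
      then have "norm (x + y) \<ge> real n" using False y by simp
      then have t: "q (x + y) = tail n (x + y)" by (simp add: tail_def)
      have "power_defect p (v x) (v (x + y)) \<le> ennreal \<epsilon> * q x + ennreal C * q (x + y)"
        unfolding q_def by (rule C)
      also have "\<dots> = ennreal \<epsilon> * q x + ennreal C * tail n (x + y)" by (simp only: t)
      also have "\<dots>
        \<le> (ennreal \<epsilon> * q x + ennreal \<epsilon> * q (x + y)) + (ennreal C * tail n x + ennreal C * tail n (x + y))"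
        by (intro add_mono) (simp_all add: add_increasing add_increasing2)
      finally show ?thesis .
    qed
    have "(\<integral>\<^sup>+x. power_defect p (v x) (v (x + y)) \<partial>lborel)
      \<le> (\<integral>\<^sup>+x. (ennreal \<epsilon> * q x + ennreal \<epsilon> * q (x + y)) + (ennreal C * tail n x + ennreal C * tail n (x + y)) \<partial>lborel)"
      by (intro nn_integral_mono pt)
    also have "\<dots> = (ennreal \<epsilon> * I + ennreal \<epsilon> * I)
        + (ennreal C * (\<integral>\<^sup>+x. tail n x \<partial>lborel) + ennreal C * (\<integral>\<^sup>+x. tail n x \<partial>lborel))"
      by (simp add: nn_integral_add nn_integral_cmult nn_integral_translate I_def)
    also have "\<dots> = ennreal (2 * \<epsilon>) * I + ennreal (2 * C) * (\<integral>\<^sup>+x. tail n x \<partial>lborel)"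
    proof -
      have "ennreal (2 * r) = ennreal r + ennreal r" if "r \<ge> 0" for r
        using ennreal_plus[OF that that] by simp
      then show ?thesis using \<epsilon>(2) C(1) by (simp only: less_imp_le distrib_right)
    qed
    also note n
    finally show ?thesis .
  qed
  have "eventually (\<lambda>t. 2 * real n / norm z \<le> t) at_top" by (rule eventually_ge_at_top)
  then show "eventually (\<lambda>t. (\<integral>\<^sup>+x. power_defect p (v x) (v (x + t *\<^sub>R z)) \<partial>lborel) < a) at_top"
  proof eventually_elim
    case (elim t)
    then have "2 * real n \<le> t * norm z" using z by (simp add: field_simps)
    also have "\<dots> \<le> \<bar>t\<bar> * norm z" by (intro mult_right_mono) auto
    finally show ?case by (intro bound) simp
  qed
qed simp

section \<open>The limit of the Gagliardo seminorm for Borel functions\<close>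

text \<open>The order enters through \<open>a = s * p\<close>, the exponent of the kernel; the integrals are
  with respect to \<open>lborel\<close> so that Tonelli's theorem is available.\<close>

definition gagliardo_Borel :: "'a::euclidean_space set \<Rightarrow> real \<Rightarrow> real \<Rightarrow> ('a \<Rightarrow> real) \<Rightarrow> ennreal" where
  "gagliardo_Borel \<Omega> a p v = (\<integral>\<^sup>+x. (\<integral>\<^sup>+y. indicator \<Omega> x * indicator \<Omega> y *
      ennreal (\<bar>v x - v y\<bar> powr p) * riesz_kernel a (x - y) \<partial>lborel) \<partial>lborel)"

lemma near_far_kernel:
  "riesz_kernel a z = riesz_kernel a z * indicator (ball 0 1) z + far_kernel a z"
  by (simp add: far_kernel_def indicator_def)

text \<open>Substituting \<open>y = x + z\<close> and exchanging the integrals leaves the far kernel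
  integrated against a bounded function of \<open>z\<close> that tends to 0 at infinity.\<close>

lemma far_power_defect_tendsto_0:
  fixes v :: "'a::euclidean_space \<Rightarrow> real"
  assumes [measurable]: "v \<in> borel_measurable borel" and p: "p > 0"
    and fin: "(\<integral>\<^sup>+x. ennreal (\<bar>v x\<bar> powr p) \<partial>lborel) < \<infinity>"
  shows "((\<lambda>a. ennreal a * (\<integral>\<^sup>+x. (\<integral>\<^sup>+y. power_defect p (v x) (v y) * far_kernel a (x - y) \<partial>lborel) \<partial>lborel))
     \<longlongrightarrow> 0) (at_right 0)"
proof -
  define e where "e z = (\<integral>\<^sup>+x. power_defect p (v x) (v (x + z)) \<partial>lborel)" for z
  have [measurable]: "e \<in> borel_measurable borel" unfolding e_def by measurable
  obtain K where K: "K < \<infinity>" "\<And>z. e z \<le> K"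
    using power_defect_integral_bounded[OF assms] unfolding e_def by blast
  have "(\<integral>\<^sup>+x. (\<integral>\<^sup>+y. power_defect p (v x) (v y) * far_kernel a (x - y) \<partial>lborel) \<partial>lborel)
    = (\<integral>\<^sup>+z. (e z * indicator (- ball 0 1) z) * riesz_kernel a z \<partial>lborel)" for a
  proof -
    have "(\<integral>\<^sup>+x. (\<integral>\<^sup>+y. power_defect p (v x) (v y) * far_kernel a (x - y) \<partial>lborel) \<partial>lborel)
      = (\<integral>\<^sup>+x. (\<integral>\<^sup>+z. power_defect p (v x) (v (x + z)) * far_kernel a z \<partial>lborel) \<partial>lborel)"
    proof (rule nn_integral_cong)
      fix x
      show "(\<integral>\<^sup>+y. power_defect p (v x) (v y) * far_kernel a (x - y) \<partial>lborel)
        = (\<integral>\<^sup>+z. power_defect p (v x) (v (x + z)) * far_kernel a z \<partial>lborel)"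
        by (subst nn_integral_lborel_affine[of _ 1 x]) (auto simp: far_kernel_minus)
    qed
    also have "\<dots> = (\<integral>\<^sup>+z. (\<integral>\<^sup>+x. power_defect p (v x) (v (x + z)) * far_kernel a z \<partial>lborel) \<partial>lborel)"
      by (rule lborel_pair.Fubini'[symmetric]) measurable
    also have "\<dots> = (\<integral>\<^sup>+z. (e z * indicator (- ball 0 1) z) * riesz_kernel a z \<partial>lborel)"
      unfolding e_def far_kernel_def by (simp add: nn_integral_multc mult.assoc)
    finally show ?thesis .
  qed
  moreover have "((\<lambda>a. ennreal a * (\<integral>\<^sup>+z. (e z * indicator (- ball 0 1) z) * riesz_kernel a z \<partial>lborel))
    \<longlongrightarrow> of_nat DIM('a) * (\<integral>\<^sup>+z. 0 * indicator (ball 0 1) z \<partial>(lborel :: 'a measure))) (at_right 0)"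
  proof (rule riesz_integral_tendsto[where M=K and \<rho>=1])
    show "e z * indicator (- ball 0 1) z \<le> K" for z
      using K(2)[of z] by (simp add: indicator_def)
    show "AE z in lborel. z \<in> ball (0::'a) 1 \<longrightarrow> ((\<lambda>t. e (t *\<^sub>R z) * indicator (- ball 0 1) (t *\<^sub>R z)) \<longlongrightarrow> 0) at_top"
      using AE_lborel_singleton[of 0]
    proof (eventually_elim, intro impI)
      fix z :: 'a assume "z \<noteq> 0"
      then have "((\<lambda>t. e (t *\<^sub>R z)) \<longlongrightarrow> 0) at_top"
        unfolding e_def by (intro power_defect_integral_tendsto_0 assms)
      then show "((\<lambda>t. e (t *\<^sub>R z) * indicator (- ball 0 1) (t *\<^sub>R z)) \<longlongrightarrow> 0) at_top"
        by (intro tendsto_sandwich[OF _ _ tendsto_const \<open>((\<lambda>t. e (t *\<^sub>R z)) \<longlongrightarrow> 0) at_top\<close>])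
           (auto intro!: always_eventually simp: indicator_def)
    qed
  qed (use K in auto)
  ultimately show ?thesis by simp
qed

text \<open>On the unit ball the kernel increases with its order, so the integral is bounded by the finite
  seminorm of order \<open>b\<close>, and the factor \<open>a\<close> sends it to 0.\<close>

lemma near_gagliardo_tendsto_0:
  fixes v :: "'a::euclidean_space \<Rightarrow> real"
  assumes b: "b > 0" and fin: "gagliardo_Borel \<Omega> b p v < \<infinity>"
  shows "((\<lambda>a. ennreal a * (\<integral>\<^sup>+x. (\<integral>\<^sup>+y. indicator \<Omega> x * indicator \<Omega> y *
      ennreal (\<bar>v x - v y\<bar> powr p) * (riesz_kernel a (x - y) * indicator (ball 0 1) (x - y)) \<partial>lborel) \<partial>lborel))
      \<longlongrightarrow> 0) (at_right 0)"
    (is "((\<lambda>a. ennreal a * ?N a) \<longlongrightarrow> 0) _")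
proof -
  have kernel: "riesz_kernel a z * indicator (ball 0 1) z \<le> riesz_kernel b z" if "a < b" for a and z :: 'a
  proof (cases "z = 0 \<or> norm z \<ge> 1")
    case False
    then have "norm z powr (real DIM('a) + b) \<le> norm z powr (real DIM('a) + a)"
      using that by (intro powr_mono') auto
    then show ?thesis using False
      unfolding riesz_kernel_def by (auto simp: indicator_def intro!: ennreal_leI divide_left_mono mult_pos_pos)
  qed (auto simp: riesz_kernel_def)
  have "?N a \<le> gagliardo_Borel \<Omega> b p v" if "a < b" for a
    unfolding gagliardo_Borel_def by (intro nn_integral_mono mult_left_mono kernel that) auto
  then have le: "eventually (\<lambda>a. ennreal a * ?N a \<le> ennreal a * gagliardo_Borel \<Omega> b p v) (at_right 0)"
    using eventually_at_right_real[OF b] by (auto elim!: eventually_mono intro!: mult_left_mono)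
  have "((\<lambda>a. ennreal a * gagliardo_Borel \<Omega> b p v) \<longlongrightarrow> ennreal 0 * gagliardo_Borel \<Omega> b p v) (at_right 0)"
    using fin by (intro tendsto_mult_ennreal tendsto_ennrealI tendsto_intros) auto
  then have "((\<lambda>a. ennreal a * gagliardo_Borel \<Omega> b p v) \<longlongrightarrow> 0) (at_right 0)"
    by simp
  then show ?thesis
    by (rule tendsto_sandwich[OF _ le tendsto_const, rotated]) simp
qed

text \<open>The seminorm splits into a near part \<open>N\<close> and a far part \<open>F\<close>. The
  latter differs by at most the defect integral \<open>D\<close> from the integral
  \<open>P\<close> of \<open>\<bar>v x\<bar> powr p + \<bar>v y\<bar> powr p\<close>, which is
  twice \<open>H\<close> by symmetry. After multiplication by \<open>a\<close>, both
  \<open>N\<close> and \<open>D\<close> tend to 0.\<close>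

lemma gagliardo_Borel_tendsto:
  fixes \<Omega> :: "'a::euclidean_space set" and v :: "'a \<Rightarrow> real"
  assumes \<Omega>: "open \<Omega>" and rays: "AE x in lborel. x \<in> \<Omega> \<longrightarrow> ray_limits_exist \<Omega> x"
    and v[measurable]: "v \<in> borel_measurable borel" and off: "\<And>x. x \<notin> \<Omega> \<Longrightarrow> v x = 0"
    and p: "p > 0" and Lp: "(\<integral>\<^sup>+x. ennreal (\<bar>v x\<bar> powr p) \<partial>lborel) < \<infinity>"
    and b: "b > 0" and fin: "gagliardo_Borel \<Omega> b p v < \<infinity>"
  shows "((\<lambda>a. ennreal a * gagliardo_Borel \<Omega> a p v) \<longlongrightarrow>
    2 * (\<integral>\<^sup>+x. ennreal (\<bar>v x\<bar> powr p) * emeasure sphere_measure (sphere 0 1 - escape_sector \<Omega> x) \<partial>lborel)) (at_right 0)"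
proof -
  have \<Omega>_borel[measurable]: "\<Omega> \<in> sets borel" using \<Omega> by simp
  define q where "q x = ennreal (\<bar>v x\<bar> powr p)" for x
  have q_meas[measurable]: "q \<in> borel_measurable borel" unfolding q_def by measurable
  have qoff: "q x = 0" if "x \<notin> \<Omega>" for x using off[OF that] by (simp add: q_def)
  define L where "L = (\<integral>\<^sup>+x. q x * emeasure sphere_measure (sphere 0 1 - escape_sector \<Omega> x) \<partial>lborel)"
  define N where "N a = (\<integral>\<^sup>+x. (\<integral>\<^sup>+y. indicator \<Omega> x * indicator \<Omega> y *
      ennreal (\<bar>v x - v y\<bar> powr p) * (riesz_kernel a (x - y) * indicator (ball 0 1) (x - y)) \<partial>lborel) \<partial>lborel)" for a
  define F where "F a = (\<integral>\<^sup>+x. (\<integral>\<^sup>+y. indicator \<Omega> x * indicator \<Omega> y *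
      ennreal (\<bar>v x - v y\<bar> powr p) * far_kernel a (x - y) \<partial>lborel) \<partial>lborel)" for a
  define D where "D a = (\<integral>\<^sup>+x. (\<integral>\<^sup>+y. power_defect p (v x) (v y) * far_kernel a (x - y) \<partial>lborel) \<partial>lborel)" for a
  define P where "P a = (\<integral>\<^sup>+x. (\<integral>\<^sup>+y. (q x * indicator \<Omega> y + q y * indicator \<Omega> x) * far_kernel a (x - y) \<partial>lborel) \<partial>lborel)" for a
  define H where "H a = (\<integral>\<^sup>+x. q x * (\<integral>\<^sup>+y. indicator \<Omega> y * far_kernel a (x - y) \<partial>lborel) \<partial>lborel)" for a

  have split: "gagliardo_Borel \<Omega> a p v = N a + F a" for a
  proof -
    have "c * riesz_kernel a z = c * (riesz_kernel a z * indicator (ball 0 1) z) + c * far_kernel a z" for c and z :: 'a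
      by (subst near_far_kernel) (rule distrib_left)
    then show ?thesis
      unfolding gagliardo_Borel_def N_def F_def by (simp add: nn_integral_add)
  qed

  have H_lim: "((\<lambda>a. ennreal a * H a) \<longlongrightarrow> L) (at_right 0)"
  proof -
    have "ennreal a * H a = (\<integral>\<^sup>+x. q x * (ennreal a * (\<integral>\<^sup>+y. indicator \<Omega> y * far_kernel a (x - y) \<partial>lborel)) \<partial>lborel)" for a
      unfolding H_def by (subst nn_integral_cmult[symmetric]) (auto simp: ac_simps)
    then show ?thesis
      using weighted_remain_integral_tendsto[OF \<Omega> rays q_meas qoff] Lp by (simp add: L_def q_def)
  qed
  have P_eq: "P a = 2 * H a" for a
  proof -
    have "P a = (\<integral>\<^sup>+x. (\<integral>\<^sup>+y. q x * indicator \<Omega> y * far_kernel a (x - y) \<partial>lborel) \<partial>lborel)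
      + (\<integral>\<^sup>+x. (\<integral>\<^sup>+y. q y * indicator \<Omega> x * far_kernel a (x - y) \<partial>lborel) \<partial>lborel)"
      unfolding P_def by (simp add: distrib_right nn_integral_add)
    also have "(\<integral>\<^sup>+x. (\<integral>\<^sup>+y. q y * indicator \<Omega> x * far_kernel a (x - y) \<partial>lborel) \<partial>lborel)
      = (\<integral>\<^sup>+y. (\<integral>\<^sup>+x. q y * indicator \<Omega> x * far_kernel a (x - y) \<partial>lborel) \<partial>lborel)"
      by (rule lborel_pair.Fubini') measurable
    also have "\<dots> = (\<integral>\<^sup>+x. (\<integral>\<^sup>+y. q x * indicator \<Omega> y * far_kernel a (x - y) \<partial>lborel) \<partial>lborel)"
    proof -
      have "far_kernel a (y - x) = far_kernel a (x - y)" for x y :: 'a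
        using far_kernel_minus[of a "x - y"] by simp
      then show ?thesis by (intro nn_integral_cong) simp
    qed
    also have "\<dots> = H a"
      unfolding H_def by (simp add: mult.assoc nn_integral_cmult)
    finally show ?thesis by (simp add: mult_2)
  qed
  have P_lim: "((\<lambda>a. ennreal a * P a) \<longlongrightarrow> 2 * L) (at_right 0)"
    using tendsto_mult_ennreal[OF tendsto_const[of "2::ennreal"] H_lim]
    by (simp add: P_eq ac_simps)
  have D_lim: "((\<lambda>a. ennreal a * D a) \<longlongrightarrow> 0) (at_right 0)"
    unfolding D_def by (rule far_power_defect_tendsto_0[OF v p Lp])

  \<comment> \<open>Since the defect is an absolute value, \<open>F\<close> and \<open>P\<close> bound each other up to \<open>D\<close>.\<close>
  have le1: "ennreal (\<bar>s - t\<bar> powr p) \<le> (ennreal (\<bar>s\<bar> powr p) + ennreal (\<bar>t\<bar> powr p)) + power_defect p s t"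
    and le2: "ennreal (\<bar>s\<bar> powr p) + ennreal (\<bar>t\<bar> powr p) \<le> ennreal (\<bar>s - t\<bar> powr p) + power_defect p s t" for s t
  proof -
    have *: "ennreal A \<le> (ennreal S + ennreal T) + ennreal \<bar>A - S - T\<bar>"
       "ennreal S + ennreal T \<le> ennreal A + ennreal \<bar>A - S - T\<bar>" if "0 \<le> A" "0 \<le> S" "0 \<le> T" for A S T
      using that by (simp_all flip: ennreal_plus add: ennreal_leI)
    show "ennreal (\<bar>s - t\<bar> powr p) \<le> (ennreal (\<bar>s\<bar> powr p) + ennreal (\<bar>t\<bar> powr p)) + power_defect p s t"
      "ennreal (\<bar>s\<bar> powr p) + ennreal (\<bar>t\<bar> powr p) \<le> ennreal (\<bar>s - t\<bar> powr p) + power_defect p s t"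
      unfolding power_defect_def by (intro * powr_ge_zero)+
  qed
  have F_le: "F a \<le> P a + D a" for a
  proof -
    have "F a \<le> (\<integral>\<^sup>+x. (\<integral>\<^sup>+y. ((q x * indicator \<Omega> y + q y * indicator \<Omega> x) + power_defect p (v x) (v y)) * far_kernel a (x - y) \<partial>lborel) \<partial>lborel)"
      unfolding F_def using le1
      by (intro nn_integral_mono mult_right_mono) (auto simp: q_def indicator_def)
    also have "\<dots> = P a + D a"
      unfolding P_def D_def by (simp add: distrib_right[of _ "power_defect _ _ _"] nn_integral_add)
    finally show ?thesis .
  qed
  have P_le: "P a \<le> F a + D a" for a
  proof -
    have "P a \<le> (\<integral>\<^sup>+x. (\<integral>\<^sup>+y. (indicator \<Omega> x * indicator \<Omega> y * ennreal (\<bar>v x - v y\<bar> powr p)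
        + power_defect p (v x) (v y)) * far_kernel a (x - y) \<partial>lborel) \<partial>lborel)"
      unfolding P_def
    proof (intro nn_integral_mono mult_right_mono)
      fix x y
      show "q x * indicator \<Omega> y + q y * indicator \<Omega> x
        \<le> indicator \<Omega> x * indicator \<Omega> y * ennreal (\<bar>v x - v y\<bar> powr p) + power_defect p (v x) (v y)"
        using le2[of "v x" "v y"] qoff by (cases "x \<in> \<Omega>"; cases "y \<in> \<Omega>") (auto simp: q_def)
    qed auto
    also have "\<dots> = F a + D a"
      unfolding F_def D_def by (simp add: distrib_right[of _ "power_defect _ _ _"] nn_integral_add)
    finally show ?thesis .
  qed
  have "L < \<infinity>"
  proof -
    have "L \<le> (\<integral>\<^sup>+x. q x * emeasure sphere_measure (UNIV :: 'a set) \<partial>lborel)"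
      unfolding L_def by (intro nn_integral_mono mult_left_mono emeasure_mono) auto
    also have "\<dots> < \<infinity>"
      using Lp sphere_measure.emeasure_finite[of "UNIV :: 'a set"]
      by (simp add: nn_integral_multc q_def ennreal_mult_less_top top.not_eq_extremum[symmetric])
         (simp add: ennreal_mult_eq_top_iff)
    finally show ?thesis .
  qed
  have F_lim: "((\<lambda>a. ennreal a * F a) \<longlongrightarrow> 2 * L) (at_right 0)"
  proof (rule tendsto_sandwich[where f="\<lambda>a. ennreal a * P a - ennreal a * D a"
        and h="\<lambda>a. ennreal a * P a + ennreal a * D a"])
    show "((\<lambda>a. ennreal a * P a + ennreal a * D a) \<longlongrightarrow> 2 * L) (at_right 0)"
      using tendsto_add[OF P_lim D_lim] by simp
    show "((\<lambda>a. ennreal a * P a - ennreal a * D a) \<longlongrightarrow> 2 * L) (at_right 0)"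
      using tendsto_diff_ennreal[OF P_lim D_lim] \<open>L < \<infinity>\<close> by (simp add: ennreal_mult_eq_top_iff)
    show "eventually (\<lambda>a. ennreal a * F a \<le> ennreal a * P a + ennreal a * D a) (at_right 0)"
      unfolding distrib_left[symmetric] by (intro always_eventually allI mult_left_mono F_le) simp
    \<comment> \<open>Finiteness of the subtrahend permits cancellation in \<^typ>\<open>ennreal\<close>.\<close>
    have "eventually (\<lambda>a. ennreal a * D a < top) (at_right 0)"
      using D_lim by (rule order_tendstoD) simp
    then show "eventually (\<lambda>a. ennreal a * P a - ennreal a * D a \<le> ennreal a * F a) (at_right 0)"
    proof eventually_elim
      case (elim a)
      have "ennreal a * P a \<le> ennreal a * F a + ennreal a * D a"
        unfolding distrib_left[symmetric] by (intro mult_left_mono P_le) simp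
      then have "ennreal a * P a - ennreal a * D a \<le> (ennreal a * F a + ennreal a * D a) - ennreal a * D a"
        by (rule ennreal_minus_mono) simp
      then show ?case using elim by simp
    qed
  qed
  have "((\<lambda>a. ennreal a * N a) \<longlongrightarrow> 0) (at_right 0)"
    unfolding N_def by (rule near_gagliardo_tendsto_0[OF b fin])
  from tendsto_add[OF this F_lim] show ?thesis
    by (simp add: split distrib_left L_def q_def)
qed

section \<open>Passage to Lebesgue measurable functions\<close>

text \<open>Tonelli's theorem needs functions that are Borel measurable, not only Lebesgue measurable;
  extending by 0 turns integrals over \<open>\<Omega>\<close> into integrals over the whole space.\<close>

lemma Lp_Borel_representative:
  assumes \<Omega>: "open \<Omega>" and u: "u \<in> Lp_space \<Omega> p"
  obtains v where "v \<in> borel_measurable borel" "\<And>x. x \<notin> \<Omega> \<Longrightarrow> v x = 0"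
    "AE x in lborel. x \<in> \<Omega> \<longrightarrow> u x = v x"
proof -
  have "\<Omega> \<in> sets lebesgue" using \<Omega> by simp
  then have "(\<lambda>x. indicator \<Omega> x *\<^sub>R u x) \<in> borel_measurable lebesgue"
    using u by (subst borel_measurable_restrict_space_iff[symmetric]) (auto simp: Lp_space_def)
  then obtain w where w: "w \<in> borel_measurable lborel" "AE x in lborel. indicator \<Omega> x *\<^sub>R u x = w x"
    using completion_ex_borel_measurable_real by blast
  define v where "v x = indicator \<Omega> x * w x" for x
  have "v \<in> borel_measurable borel"
    using w(1) \<Omega> unfolding v_def by (intro borel_measurable_times borel_measurable_indicator) auto
  moreover have "AE x in lborel. x \<in> \<Omega> \<longrightarrow> u x = v x"
    using w(2) by eventually_elim (auto simp: v_def)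
  ultimately show ?thesis using that by (simp add: v_def)
qed

lemma nn_integral_representative:
  fixes c :: "'a::euclidean_space \<Rightarrow> ennreal"
  assumes off: "\<And>x. x \<notin> \<Omega> \<Longrightarrow> v x = 0" and ae: "AE x in lborel. x \<in> \<Omega> \<longrightarrow> u x = v x"
  shows "(\<integral>\<^sup>+x\<in>\<Omega>. ennreal (\<bar>u x\<bar> powr p) * c x \<partial>lebesgue) = (\<integral>\<^sup>+x. ennreal (\<bar>v x\<bar> powr p) * c x \<partial>lborel)"
  unfolding nn_integral_completion
proof (rule nn_integral_cong_AE)
  show "AE x in lborel. ennreal (\<bar>u x\<bar> powr p) * c x * indicator \<Omega> x = ennreal (\<bar>v x\<bar> powr p) * c x"
    using ae by eventually_elim (auto simp: off indicator_def)
qed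

lemma gagliardo_eq_Borel:
  fixes \<Omega> :: "'a::euclidean_space set"
  assumes ae: "AE x in lborel. x \<in> \<Omega> \<longrightarrow> u x = v x"
  shows "gagliardo \<Omega> s p u = gagliardo_Borel \<Omega> (s * p) p v"
  unfolding gagliardo_def gagliardo_Borel_def nn_integral_completion
proof (rule nn_integral_cong_AE)
  show "AE x in lborel. (\<integral>\<^sup>+y\<in>\<Omega>. ennreal (\<bar>u x - u y\<bar> powr p / norm (x - y) powr (real DIM('a) + s * p)) \<partial>lborel) * indicator \<Omega> x
    = (\<integral>\<^sup>+y. indicator \<Omega> x * indicator \<Omega> y * ennreal (\<bar>v x - v y\<bar> powr p) * riesz_kernel (s * p) (x - y) \<partial>lborel)"
    using ae
  proof eventually_elim
    fix x assume x: "x \<in> \<Omega> \<longrightarrow> u x = v x"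
    show "(\<integral>\<^sup>+y\<in>\<Omega>. ennreal (\<bar>u x - u y\<bar> powr p / norm (x - y) powr (real DIM('a) + s * p)) \<partial>lborel) * indicator \<Omega> x
      = (\<integral>\<^sup>+y. indicator \<Omega> x * indicator \<Omega> y * ennreal (\<bar>v x - v y\<bar> powr p) * riesz_kernel (s * p) (x - y) \<partial>lborel)"
    proof (cases "x \<in> \<Omega>")
      case True
      have "(\<integral>\<^sup>+y\<in>\<Omega>. ennreal (\<bar>u x - u y\<bar> powr p / norm (x - y) powr (real DIM('a) + s * p)) \<partial>lborel)
        = (\<integral>\<^sup>+y. indicator \<Omega> y * ennreal (\<bar>v x - v y\<bar> powr p) * riesz_kernel (s * p) (x - y) \<partial>lborel)"
      proof (rule nn_integral_cong_AE)
        show "AE y in lborel. ennreal (\<bar>u x - u y\<bar> powr p / norm (x - y) powr (real DIM('a) + s * p)) * indicator \<Omega> y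
          = indicator \<Omega> y * ennreal (\<bar>v x - v y\<bar> powr p) * riesz_kernel (s * p) (x - y)"
          using ae
        proof eventually_elim
          case (elim y)
          have "ennreal (\<bar>u x - u y\<bar> powr p / norm (x - y) powr (real DIM('a) + s * p))
            = ennreal (\<bar>u x - u y\<bar> powr p) * riesz_kernel (s * p) (x - y)"
            unfolding riesz_kernel_def by (subst ennreal_mult[symmetric]) auto
          then show ?case
            using elim x True by (auto simp: indicator_def)
        qed
      qed
      then show ?thesis using True by simp
    qed simp
  qed
qed

lemma radial_limits_exist_iff:
  "radial_limits_exist \<Omega> \<longleftrightarrow> (AE x in lborel. x \<in> \<Omega> \<longrightarrow> ray_limits_exist \<Omega> x)"
  unfolding radial_limits_exist_def ray_limits_exist_def AE_completion_iff ..

lemma filterlim_times_at_right_0: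
  "p > 0 \<Longrightarrow> filterlim (\<lambda>s. s * p) (at_right 0) (at_right (0::real))"
proof -
  assume p: "p > 0"
  have "((\<lambda>s. s * p) \<longlongrightarrow> 0 * p) (at_right 0)" by (intro tendsto_intros)
  moreover have "eventually (\<lambda>s. s * p > 0) (at_right 0)"
    using eventually_at_right_less[of "0::real"] by eventually_elim (use p in simp)
  ultimately show ?thesis by (auto simp: filterlim_at elim: eventually_mono)
qed

lemma escape_remain_area:
  fixes \<Omega> :: "'a::euclidean_space set"
  assumes "open \<Omega>"
  shows "ennreal (sphere_area (sphere 0 1 :: 'a set) - sphere_area (escape_sector \<Omega> x))
    = emeasure sphere_measure (sphere 0 1 - escape_sector \<Omega> x)"
proof -
  have "measure sphere_measure (sphere 0 1 - escape_sector \<Omega> x)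
     = measure sphere_measure (sphere (0::'a) 1) - measure sphere_measure (escape_sector \<Omega> x)"
    using escape_sector_borel[OF assms, of x]
    by (intro sphere_measure.finite_measure_Diff) (auto simp: escape_sector_iff)
  then show ?thesis
    by (simp add: sphere_area_def sphere_measure.emeasure_eq_measure)
qed

lemma gagliardo_tendsto:
  fixes \<Omega> :: "'a::euclidean_space set"
  assumes \<Omega>: "open \<Omega>" and rays: "radial_limits_exist \<Omega>" and p: "1 \<le> p"
    and u: "u \<in> frac_Sobolev \<Omega> b p" and b: "0 < b"
  shows "((\<lambda>s. ennreal (s * (1 - s)) * gagliardo \<Omega> s p u)
        \<longlongrightarrow> ennreal (2 / p) *
           (\<integral>\<^sup>+x\<in>\<Omega>. ennreal ((sphere_area (sphere 0 1 :: 'a set) - sphere_area (escape_sector \<Omega> x))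
              * \<bar>u x\<bar> powr p) \<partial>lebesgue)) (at_right 0)"
proof -
  have p0: "p > 0" using p by simp
  have uLp: "u \<in> Lp_space \<Omega> p" and fin: "gagliardo \<Omega> b p u < \<infinity>"
    using u by (auto simp: frac_Sobolev_def)
  obtain v where v: "v \<in> borel_measurable borel" "\<And>x. x \<notin> \<Omega> \<Longrightarrow> v x = 0"
    "AE x in lborel. x \<in> \<Omega> \<longrightarrow> u x = v x"
    using Lp_Borel_representative[OF \<Omega> uLp] by blast
  have rep: "(\<integral>\<^sup>+x\<in>\<Omega>. ennreal (\<bar>u x\<bar> powr p) * c x \<partial>lebesgue) = (\<integral>\<^sup>+x. ennreal (\<bar>v x\<bar> powr p) * c x \<partial>lborel)" for c
    using v(2,3) by (rule nn_integral_representative)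
  define J where "J = (\<integral>\<^sup>+x. ennreal (\<bar>v x\<bar> powr p) * emeasure sphere_measure (sphere 0 1 - escape_sector \<Omega> x) \<partial>lborel)"
  have "((\<lambda>a. ennreal a * gagliardo_Borel \<Omega> a p v) \<longlongrightarrow> 2 * J) (at_right 0)"
    unfolding J_def
  proof (rule gagliardo_Borel_tendsto)
    show "AE x in lborel. x \<in> \<Omega> \<longrightarrow> ray_limits_exist \<Omega> x"
      using rays by (simp add: radial_limits_exist_iff)
    show "(\<integral>\<^sup>+x. ennreal (\<bar>v x\<bar> powr p) \<partial>lborel) < \<infinity>"
      using uLp rep[of "\<lambda>_. 1"] by (simp add: Lp_space_def)
    show "gagliardo_Borel \<Omega> (b * p) p v < \<infinity>"
      using fin by (simp add: gagliardo_eq_Borel[OF v(3)])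
  qed (use \<Omega> v b p0 in auto)
  from filterlim_compose[OF this filterlim_times_at_right_0[OF p0]]
  have "((\<lambda>s. ennreal (s * p) * gagliardo_Borel \<Omega> (s * p) p v) \<longlongrightarrow> 2 * J) (at_right 0)" .
  moreover have "((\<lambda>s. ennreal ((1 - s) / p)) \<longlongrightarrow> ennreal ((1 - 0) / p)) (at_right 0)"
    using p0 by (intro tendsto_ennrealI tendsto_intros) auto
  ultimately have "((\<lambda>s. ennreal ((1 - s) / p) * (ennreal (s * p) * gagliardo_Borel \<Omega> (s * p) p v))
     \<longlongrightarrow> ennreal ((1 - 0) / p) * (2 * J)) (at_right 0)"
    using p0 by (intro tendsto_mult_ennreal[of _ _ _ "\<lambda>s. ennreal (s * p) * gagliardo_Borel \<Omega> (s * p) p v"]) auto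
  moreover have "eventually (\<lambda>s. ennreal ((1 - s) / p) * (ennreal (s * p) * gagliardo_Borel \<Omega> (s * p) p v)
    = ennreal (s * (1 - s)) * gagliardo \<Omega> s p u) (at_right 0)"
    using eventually_at_right_real[OF zero_less_one]
  proof eventually_elim
    case (elim s)
    then have "ennreal ((1 - s) / p) * ennreal (s * p) = ennreal (s * (1 - s))"
      using p0 by (subst ennreal_mult[symmetric]) (auto simp: mult.commute)
    then show ?case by (simp add: gagliardo_eq_Borel[OF v(3)] mult.assoc[symmetric])
  qed
  ultimately have "((\<lambda>s. ennreal (s * (1 - s)) * gagliardo \<Omega> s p u) \<longlongrightarrow> ennreal ((1 - 0) / p) * (2 * J)) (at_right 0)"
    by (rule Lim_transform_eventually)
  moreover have "ennreal ((1 - 0) / p) * (2 * J) = ennreal (2 / p) * J"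
  proof -
    have "ennreal (1 / p) * 2 = ennreal (2 / p)"
      using p0 ennreal_mult[of "1 / p" 2] by simp
    then show ?thesis by (simp add: mult.assoc[symmetric])
  qed
  moreover have "J = (\<integral>\<^sup>+x\<in>\<Omega>. ennreal ((sphere_area (sphere 0 1 :: 'a set) - sphere_area (escape_sector \<Omega> x))
              * \<bar>u x\<bar> powr p) \<partial>lebesgue)"
    unfolding J_def rep[symmetric]
    by (intro nn_integral_cong, subst ennreal_mult'') (simp_all add: escape_remain_area[OF \<Omega>] mult.commute)
  ultimately show ?thesis by simp
qed

lemma escape_term_tendsto:
  fixes \<Omega> :: "'a::euclidean_space set"
  assumes \<Omega>: "open \<Omega>" and rays: "radial_limits_exist \<Omega>" and p: "1 \<le> p"
    and uLp: "u \<in> Lp_space \<Omega> p" and u: "u \<in> weighted_Lp_space \<Omega> b p" and b: "0 < b"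
  shows "((\<lambda>s. ennreal s *
           (\<integral>\<^sup>+x\<in>\<Omega>. ennreal (\<bar>u x\<bar> powr p) *
              (\<integral>\<^sup>+y\<in>- \<Omega>. ennreal (1 / norm (x - y) powr (real DIM('a) + s * p)) \<partial>lebesgue) \<partial>lebesgue))
        \<longlongrightarrow> ennreal (1 / p) *
           (\<integral>\<^sup>+x\<in>\<Omega>. ennreal (\<bar>u x\<bar> powr p * sphere_area (escape_sector \<Omega> x)) \<partial>lebesgue))
        (at_right 0)"
proof -
  have p0: "p > 0" using p by simp
  have [measurable]: "\<Omega> \<in> sets borel" using \<Omega> by simp
  obtain v where v: "v \<in> borel_measurable borel" "\<And>x. x \<notin> \<Omega> \<Longrightarrow> v x = 0"
    "AE x in lborel. x \<in> \<Omega> \<longrightarrow> u x = v x"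
    using Lp_Borel_representative[OF \<Omega> uLp] by blast
  note v(1)[measurable]
  have rep: "(\<integral>\<^sup>+x\<in>\<Omega>. ennreal (\<bar>u x\<bar> powr p) * c x \<partial>lebesgue) = (\<integral>\<^sup>+x. ennreal (\<bar>v x\<bar> powr p) * c x \<partial>lborel)" for c
    using v(2,3) by (rule nn_integral_representative)
  define J where "J = (\<integral>\<^sup>+x. ennreal (\<bar>v x\<bar> powr p) * emeasure sphere_measure (escape_sector \<Omega> x) \<partial>lborel)"
  define E where "E a = (\<integral>\<^sup>+x. ennreal (\<bar>v x\<bar> powr p) *
     (ennreal a * (\<integral>\<^sup>+y. indicator (- \<Omega>) y * riesz_kernel a (x - y) \<partial>lborel)) \<partial>lborel)" for a
  have "(E \<longlongrightarrow> J) (at_right 0)"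
    unfolding J_def E_def
  proof (rule weighted_escape_integral_tendsto)
    show "AE x in lborel. x \<in> \<Omega> \<longrightarrow> ray_limits_exist \<Omega> x"
      using rays by (simp add: radial_limits_exist_iff)
    show "(\<integral>\<^sup>+x. ennreal (\<bar>v x\<bar> powr p) \<partial>lborel) < \<infinity>"
      using uLp rep[of "\<lambda>_. 1"] by (simp add: Lp_space_def)
    have "0 \<le> boundary_weight \<Omega> (b * p) x" for x by (simp add: boundary_weight_def)
    then show "(\<integral>\<^sup>+x. ennreal (\<bar>v x\<bar> powr p) * ennreal (boundary_weight \<Omega> (b * p) x) \<partial>lborel) < \<infinity>"
      using u rep[of "\<lambda>x. ennreal (boundary_weight \<Omega> (b * p) x)"]
      by (simp add: weighted_Lp_space_def ennreal_mult)
  qed (use \<Omega> v b p0 in auto)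
  from filterlim_compose[OF this filterlim_times_at_right_0[OF p0]]
  have "((\<lambda>s. ennreal (1 / p) * E (s * p)) \<longlongrightarrow> ennreal (1 / p) * J) (at_right 0)"
    using p0 by (intro tendsto_mult_ennreal tendsto_const) auto
  moreover have "eventually (\<lambda>s. ennreal (1 / p) * E (s * p) = ennreal s *
           (\<integral>\<^sup>+x\<in>\<Omega>. ennreal (\<bar>u x\<bar> powr p) *
              (\<integral>\<^sup>+y\<in>- \<Omega>. ennreal (1 / norm (x - y) powr (real DIM('a) + s * p)) \<partial>lebesgue) \<partial>lebesgue)) (at_right 0)"
    using eventually_at_right_less[of "0::real"]
  proof eventually_elim
    case (elim s)
    have "E (s * p) = ennreal (s * p) * (\<integral>\<^sup>+x. ennreal (\<bar>v x\<bar> powr p) *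
      (\<integral>\<^sup>+y. indicator (- \<Omega>) y * riesz_kernel (s * p) (x - y) \<partial>lborel) \<partial>lborel)"
      unfolding E_def by (subst nn_integral_cmult[symmetric]) (auto simp: ac_simps)
    moreover have "ennreal (1 / p) * ennreal (s * p) = ennreal s"
      using elim p0 by (subst ennreal_mult[symmetric]) auto
    moreover have "(\<integral>\<^sup>+y\<in>- \<Omega>. ennreal (1 / norm (x - y) powr (real DIM('a) + s * p)) \<partial>lebesgue)
      = (\<integral>\<^sup>+y. indicator (- \<Omega>) y * riesz_kernel (s * p) (x - y) \<partial>lborel)" for x
      by (simp add: nn_integral_completion riesz_kernel_def mult.commute)
    ultimately show ?case
      by (simp only: rep mult.assoc[symmetric])
  qed
  ultimately have "((\<lambda>s. ennreal s *
           (\<integral>\<^sup>+x\<in>\<Omega>. ennreal (\<bar>u x\<bar> powr p) *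
              (\<integral>\<^sup>+y\<in>- \<Omega>. ennreal (1 / norm (x - y) powr (real DIM('a) + s * p)) \<partial>lebesgue) \<partial>lebesgue))
        \<longlongrightarrow> ennreal (1 / p) * J) (at_right 0)"
    by (rule Lim_transform_eventually)
  moreover have "J = (\<integral>\<^sup>+x\<in>\<Omega>. ennreal (\<bar>u x\<bar> powr p * sphere_area (escape_sector \<Omega> x)) \<partial>lebesgue)"
    unfolding J_def rep[symmetric]
    by (intro nn_integral_cong, subst ennreal_mult') (simp_all add: ennreal_sphere_area)
  ultimately show ?thesis by simp
qed

section \<open>Escape sectors of particular domains\<close>

lemma AE_sphere_measureI:
  assumes "{w. P w} \<in> sets borel" and "AE z in lborel. z \<in> ball 0 1 \<longrightarrow> P (sgn (z :: 'a::euclidean_space))"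
  shows "AE w in sphere_measure. P w"
proof -
  let ?M = "density lborel (\<lambda>x::'a. of_nat DIM('a) * indicator (ball 0 1) x)"
  have "AE z in ?M. P (sgn z)"
    using assms(2) by (subst AE_density) (auto elim!: eventually_mono split: split_indicator_asm)
  moreover have "sgn \<in> measurable ?M borel"
    by (simp add: measurable_cong_sets[of "density _ _" borel] sgn_borel_measurable)
  ultimately show ?thesis
    unfolding sphere_measure_def using assms(1) by (subst AE_distr_iff) auto
qed

lemma AE_sphere_measure_norm: "AE w in sphere_measure. norm (w :: 'a::euclidean_space) = 1"
proof (rule AE_sphere_measureI)
  have "closed {w::'a. norm w = 1}" by (intro closed_Collect_eq continuous_intros)
  then show "{w::'a. norm w = 1} \<in> sets borel" by (rule borel_closed)
  show "AE z in lborel. z \<in> ball 0 1 \<longrightarrow> norm (sgn z :: 'a) = 1"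
    using AE_lborel_singleton[of "0::'a"] by eventually_elim (simp add: norm_sgn)
qed

lemma ray_limits_existI:
  assumes "AE w in sphere_measure. norm w = 1 \<longrightarrow>
    eventually (\<lambda>r. x + r *\<^sub>R w \<in> \<Omega>) at_top \<or> eventually (\<lambda>r. x + r *\<^sub>R w \<notin> \<Omega>) at_top"
  shows "ray_limits_exist \<Omega> x"
  unfolding ray_limits_exist_def using assms AE_sphere_measure_norm
proof eventually_elim
  case (elim w)
  then consider "eventually (\<lambda>r. x + r *\<^sub>R w \<in> - \<Omega>) at_top" | "eventually (\<lambda>r. x + r *\<^sub>R w \<notin> - \<Omega>) at_top"
    by auto
  then show ?case
    using tendsto_indicator_real_iff[of "- \<Omega>" "\<lambda>r. x + r *\<^sub>R w" at_top] by cases blast+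
qed

lemma ray_avoids_bounded:
  fixes w :: "'a::euclidean_space"
  assumes "bounded B" "norm w = 1"
  obtains r0 where "\<And>r. r \<ge> r0 \<Longrightarrow> x + r *\<^sub>R w \<notin> B"
proof -
  obtain R where R: "\<And>y. y \<in> B \<Longrightarrow> norm y \<le> R" using assms(1) by (auto simp: bounded_iff)
  have "x + r *\<^sub>R w \<notin> B" if "r \<ge> max 0 (R + norm x + 1)" for r
  proof
    assume "x + r *\<^sub>R w \<in> B"
    then have "norm (x + r *\<^sub>R w) \<le> R" by (rule R)
    moreover have "norm (r *\<^sub>R w) \<le> norm (x + r *\<^sub>R w) + norm x"
      using norm_triangle_ineq4[of "x + r *\<^sub>R w" x] by simp
    ultimately show False using that assms(2) by simp
  qed
  then show ?thesis by (rule that)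
qed

lemma eventually_ray_notin_bounded:
  fixes w :: "'a::euclidean_space"
  assumes "bounded B" "norm w = 1"
  shows "eventually (\<lambda>r. x + r *\<^sub>R w \<notin> B) at_top"
  using ray_avoids_bounded[OF assms, of x] unfolding eventually_at_top_linorder by metis

text \<open>The tail of a ray is connected and misses the bounded frontier, so it lies on one side.\<close>

lemma ray_limits_exist_bounded_frontier:
  fixes \<Omega> :: "'a::euclidean_space set"
  assumes "bounded (frontier \<Omega>)"
  shows "ray_limits_exist \<Omega> x"
proof (rule ray_limits_existI, intro AE_I2 impI)
  fix w :: 'a assume w: "norm w = 1"
  obtain r0 where r0: "\<And>r. r \<ge> r0 \<Longrightarrow> x + r *\<^sub>R w \<notin> frontier \<Omega>"
    using ray_avoids_bounded[OF assms w] by blast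
  let ?ray = "(\<lambda>r. x + r *\<^sub>R w) ` {r0..}"
  have "connected ?ray"
    by (intro connected_continuous_image continuous_intros) (rule connected_Ici)
  moreover have "?ray \<inter> frontier \<Omega> = {}" using r0 by auto
  ultimately have "?ray \<inter> \<Omega> = {} \<or> ?ray - \<Omega> = {}"
    using connected_Int_frontier by blast
  then show "eventually (\<lambda>r. x + r *\<^sub>R w \<in> \<Omega>) at_top \<or> eventually (\<lambda>r. x + r *\<^sub>R w \<notin> \<Omega>) at_top"
    unfolding eventually_at_top_linorder by fastforce
qed

lemma escape_sector_bounded:
  "bounded \<Omega> \<Longrightarrow> escape_sector \<Omega> x = sphere 0 1"
  by (auto simp: escape_sector_iff eventually_ray_notin_bounded)

lemma escape_sector_bounded_complement:
  assumes "bounded (- \<Omega>)"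
  shows "escape_sector \<Omega> x = {}"
proof -
  have "\<not> eventually (\<lambda>r. x + r *\<^sub>R w \<notin> \<Omega>) at_top" if "norm w = 1" for w
  proof
    assume "eventually (\<lambda>r. x + r *\<^sub>R w \<notin> \<Omega>) at_top"
    moreover have "eventually (\<lambda>r. x + r *\<^sub>R w \<in> \<Omega>) at_top"
      using eventually_ray_notin_bounded[OF assms that] by simp
    ultimately have "eventually (\<lambda>r::real. False) at_top" by eventually_elim simp
    then show False by simp
  qed
  then show ?thesis by (auto simp: escape_sector_iff)
qed

lemma bounded_frontier_of_bounded:
  "bounded (S :: 'a::euclidean_space set) \<Longrightarrow> bounded (frontier S)"
  by (rule bounded_subset[OF bounded_closure]) (auto simp: frontier_def)

lemma eventually_halfspace_ray:
  fixes e :: "'a::euclidean_space"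
  shows "w \<bullet> e > 0 \<Longrightarrow> eventually (\<lambda>r. (x + r *\<^sub>R w) \<bullet> e > 0) at_top"
    and "w \<bullet> e < 0 \<Longrightarrow> eventually (\<lambda>r. (x + r *\<^sub>R w) \<bullet> e < 0) at_top"
proof -
  have pos: "eventually (\<lambda>r. (x + r *\<^sub>R w) \<bullet> e > 0) at_top" if "w \<bullet> e > 0" for x w e :: 'a
    using eventually_gt_at_top[of "- (x \<bullet> e) / (w \<bullet> e)"]
    by eventually_elim (use that in \<open>simp add: inner_add_left field_simps\<close>)
  show "w \<bullet> e > 0 \<Longrightarrow> eventually (\<lambda>r. (x + r *\<^sub>R w) \<bullet> e > 0) at_top" by (rule pos)
  show "w \<bullet> e < 0 \<Longrightarrow> eventually (\<lambda>r. (x + r *\<^sub>R w) \<bullet> e < 0) at_top"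
    using pos[of w "- e" x] by simp
qed

lemma escape_sector_halfspace:
  assumes "x \<bullet> e > 0"
  shows "escape_sector {x. x \<bullet> e > 0} x = {w \<in> sphere 0 1. w \<bullet> e < 0}"
proof -
  have "eventually (\<lambda>r. \<not> (x + r *\<^sub>R w) \<bullet> e > 0) at_top \<longleftrightarrow> w \<bullet> e < 0" for w
  proof
    assume ev: "eventually (\<lambda>r. \<not> (x + r *\<^sub>R w) \<bullet> e > 0) at_top"
    show "w \<bullet> e < 0"
    proof (rule ccontr)
      assume "\<not> w \<bullet> e < 0"
      then have "(x + r *\<^sub>R w) \<bullet> e > 0" if "r \<ge> 0" for r
        using assms that by (simp add: inner_add_left add_pos_nonneg)
      then have "eventually (\<lambda>r. (x + r *\<^sub>R w) \<bullet> e > 0) at_top"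
        unfolding eventually_at_top_linorder by blast
      with ev have "eventually (\<lambda>r::real. False) at_top" by eventually_elim simp
      then show False by simp
    qed
  next
    assume "w \<bullet> e < 0"
    from eventually_halfspace_ray(2)[OF this, of x]
    show "eventually (\<lambda>r. \<not> (x + r *\<^sub>R w) \<bullet> e > 0) at_top" by eventually_elim simp
  qed
  then show ?thesis
    by (intro set_eqI) (simp only: escape_sector_iff mem_Collect_eq, simp)
qed

text \<open>The hyperplane orthogonal to \<open>e\<close> is a cone and a Lebesgue null set.\<close>

lemma AE_sphere_measure_off_hyperplane:
  fixes e :: "'a::euclidean_space"
  assumes "e \<noteq> 0"
  shows "AE w in sphere_measure. w \<bullet> e \<noteq> 0"
proof (rule AE_sphere_measureI)
  have "closed {w. w \<bullet> e = 0}" by (intro closed_Collect_eq continuous_intros)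
  then show "{w. w \<bullet> e \<noteq> 0} \<in> sets borel"
    by (intro borel_open) (simp add: open_closed Compl_eq)
  have "{z. e \<bullet> z = 0} \<in> null_sets lebesgue"
    using negligible_hyperplane[of e 0] assms by (simp add: negligible_iff_null_sets)
  then have "AE z in lebesgue. \<not> e \<bullet> z = 0"
    by (rule AE_not_in[THEN eventually_mono]) auto
  then have "AE z in lborel. \<not> e \<bullet> z = 0" by (simp only: AE_completion_iff)
  then show "AE z in lborel. z \<in> ball 0 1 \<longrightarrow> sgn z \<bullet> e \<noteq> 0"
    by eventually_elim (auto simp: sgn_div_norm inner_commute)
qed

lemma ray_limits_exist_halfspace:
  fixes e :: "'a::euclidean_space"
  assumes "e \<noteq> 0"
  shows "ray_limits_exist {x. x \<bullet> e > 0} x"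
proof (rule ray_limits_existI)
  show "AE w in sphere_measure. norm w = 1 \<longrightarrow>
    eventually (\<lambda>r. x + r *\<^sub>R w \<in> {x. x \<bullet> e > 0}) at_top \<or> eventually (\<lambda>r. x + r *\<^sub>R w \<notin> {x. x \<bullet> e > 0}) at_top"
    using AE_sphere_measure_off_hyperplane[OF assms]
  proof eventually_elim
    case (elim w)
    then consider "w \<bullet> e > 0" | "w \<bullet> e < 0" by linarith
    then show ?case
    proof cases
      case 1
      then show ?thesis using eventually_halfspace_ray(1) by auto
    next
      case 2
      from eventually_halfspace_ray(2)[OF this, of x]
      have "eventually (\<lambda>r. x + r *\<^sub>R w \<notin> {x. x \<bullet> e > 0}) at_top" by eventually_elim simp
      then show ?thesis by simp
    qed
  qed
qed

lemma emeasure_sphere_measure_uminus: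
  fixes A :: "'a::euclidean_space set"
  assumes [measurable]: "A \<in> sets borel"
  shows "emeasure sphere_measure {w. - w \<in> A} = emeasure sphere_measure A"
proof -
  note sgn_borel_measurable[measurable]
  have [measurable]: "{w. - w \<in> A} \<in> sets borel"
    using measurable_sets[of uminus borel borel A] assms by (simp add: vimage_def)
  have "(\<integral>\<^sup>+z. indicator A (sgn z) * indicator (ball 0 1) z \<partial>lborel)
    = (\<integral>\<^sup>+z. indicator {w. - w \<in> A} (sgn z) * indicator (ball (0::'a) 1) z \<partial>lborel)"
    by (subst nn_integral_lborel_affine[of _ "-1" 0])
       (auto simp: sgn_minus indicator_def)
  then show ?thesis by (simp add: emeasure_sphere_measure_eq)
qed

text \<open>Up to the null set of directions orthogonal to \<open>e\<close>, the sphere is the disjoint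
  union of the set and its reflection.\<close>

lemma sphere_area_half:
  fixes e :: "'a::euclidean_space"
  assumes "e \<noteq> 0"
  shows "sphere_area (sphere 0 1 :: 'a set) = 2 * sphere_area {w \<in> sphere 0 1. w \<bullet> e < 0}"
proof -
  define N where "N = {w \<in> sphere 0 1. w \<bullet> e < 0}"
  have N_eq: "N = sphere 0 1 \<inter> {w. w \<bullet> e < 0}" by (auto simp: N_def)
  have "open {w. w \<bullet> e < 0}" by (intro open_Collect_less continuous_intros)
  then have N[measurable]: "N \<in> sets borel" unfolding N_eq by auto
  have N': "{w. - w \<in> N} \<in> sets borel"
    using measurable_sets[of uminus borel borel N] N by (simp add: vimage_def)
  have "emeasure sphere_measure (sphere (0::'a) 1) = emeasure sphere_measure (N \<union> {w. - w \<in> N})"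
  proof (rule emeasure_eq_AE)
    show "AE w in sphere_measure. (w \<in> sphere 0 1) = (w \<in> N \<union> {w. - w \<in> N})"
      using AE_sphere_measure_off_hyperplane[OF assms]
      by eventually_elim (auto simp: N_def)
  qed (use N N' in auto)
  also have "\<dots> = emeasure sphere_measure N + emeasure sphere_measure {w. - w \<in> N}"
    using N N' by (intro plus_emeasure[symmetric]) (auto simp: N_def)
  also have "\<dots> = 2 * emeasure sphere_measure N"
    by (simp add: emeasure_sphere_measure_uminus mult_2)
  finally have "ennreal (sphere_area (sphere 0 1 :: 'a set)) = ennreal (2 * sphere_area N)"
    by (simp add: ennreal_mult' ennreal_sphere_area)
  then show ?thesis by (simp add: N_def sphere_area_def)
qed

section \<open>The limits as the order tends to zero\<close>

theorem theorem4p6: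
  fixes \<Omega> :: "'a::euclidean_space set" and u :: "'a \<Rightarrow> real" and p :: real and e :: 'a
  assumes "open \<Omega>" and "1 \<le> p" and "u \<in> Lp_space \<Omega> p"
    and "e \<in> Basis" \<comment> \<open>the direction of the last coordinate axis\<close>
  shows
    \<comment> \<open>(1)\<close>
    "(radial_limits_exist \<Omega> \<and> u \<in> (\<Union>s\<in>{0<..<1}. weighted_Lp_space \<Omega> s p) \<longrightarrow>
      ((\<lambda>s. ennreal s *
           (\<integral>\<^sup>+x\<in>\<Omega>. ennreal (\<bar>u x\<bar> powr p) *
              (\<integral>\<^sup>+y\<in>- \<Omega>. ennreal (1 / norm (x - y) powr (real DIM('a) + s * p)) \<partial>lebesgue) \<partial>lebesgue))
        \<longlongrightarrow> ennreal (1 / p) *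
           (\<integral>\<^sup>+x\<in>\<Omega>. ennreal (\<bar>u x\<bar> powr p * sphere_area (escape_sector \<Omega> x)) \<partial>lebesgue))
        (at_right 0))
    \<and> \<comment> \<open>(2)\<close>
     (radial_limits_exist \<Omega> \<and>
      u \<in> (\<Union>s\<in>{0<..<1}. frac_Sobolev \<Omega> s p \<inter> weighted_Lp_space \<Omega> s p) \<longrightarrow>
      ((\<lambda>s. ennreal (s * (1 - s)) * gagliardo \<Omega> s p u)
        \<longlongrightarrow> ennreal (2 / p) *
           (\<integral>\<^sup>+x\<in>\<Omega>. ennreal ((sphere_area (sphere 0 1 :: 'a set) - sphere_area (escape_sector \<Omega> x))
              * \<bar>u x\<bar> powr p) \<partial>lebesgue))
        (at_right 0))
    \<and> \<comment> \<open>(3)\<close>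
     ((compact (frontier \<Omega>) \<and> Lipschitz_boundary \<Omega> \<or>
        (\<exists>\<zeta>. Lipschitz_off e \<zeta> \<and> \<Omega> = epigraph_along e \<zeta>) \<and> radial_limits_exist \<Omega>) \<and>
      u \<in> (\<Union>s\<in>{0<..<1}. frac_Sobolev \<Omega> s p) \<longrightarrow>
      ((\<lambda>s. ennreal (s * (1 - s)) * gagliardo \<Omega> s p u)
        \<longlongrightarrow> ennreal (2 / p) *
           (\<integral>\<^sup>+x\<in>\<Omega>. ennreal ((sphere_area (sphere 0 1 :: 'a set) - sphere_area (escape_sector \<Omega> x))
              * \<bar>u x\<bar> powr p) \<partial>lebesgue))
        (at_right 0))
    \<and> \<comment> \<open>(4)\<close>
     (u \<in> (\<Union>s\<in>{0<..<1}. frac_Sobolev \<Omega> s p \<inter> weighted_Lp_space \<Omega> s p) \<or>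
      (compact (frontier \<Omega>) \<and> Lipschitz_boundary \<Omega> \<or>
        (\<exists>\<zeta>. Lipschitz_off e \<zeta> \<and> \<Omega> = epigraph_along e \<zeta>)) \<and>
      u \<in> (\<Union>s\<in>{0<..<1}. frac_Sobolev \<Omega> s p) \<longrightarrow>
      (bounded \<Omega> \<longrightarrow>
        ((\<lambda>s. ennreal (s * (1 - s)) * gagliardo \<Omega> s p u) \<longlongrightarrow> 0) (at_right 0)) \<and>
      (bounded (- \<Omega>) \<longrightarrow>
        ((\<lambda>s. ennreal (s * (1 - s)) * gagliardo \<Omega> s p u)
          \<longlongrightarrow> ennreal (2 * sphere_area (sphere 0 1 :: 'a set) / p) *
             (\<integral>\<^sup>+x\<in>\<Omega>. ennreal (\<bar>u x\<bar> powr p) \<partial>lebesgue)) (at_right 0)) \<and>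
      (\<Omega> = {x. x \<bullet> e > 0} \<longrightarrow>
        ((\<lambda>s. ennreal (s * (1 - s)) * gagliardo \<Omega> s p u)
          \<longlongrightarrow> ennreal (sphere_area (sphere 0 1 :: 'a set) / p) *
             (\<integral>\<^sup>+x\<in>{x. x \<bullet> e > 0}. ennreal (\<bar>u x\<bar> powr p) \<partial>lebesgue)) (at_right 0)))"
proof (intro conjI impI)
  have sector_limit: "((\<lambda>s. ennreal (s * (1 - s)) * gagliardo \<Omega> s p u)
        \<longlongrightarrow> ennreal (2 / p) *
           (\<integral>\<^sup>+x\<in>\<Omega>. ennreal ((sphere_area (sphere 0 1 :: 'a set) - sphere_area (escape_sector \<Omega> x))
              * \<bar>u x\<bar> powr p) \<partial>lebesgue)) (at_right 0)"
    if "radial_limits_exist \<Omega>" "u \<in> (\<Union>s\<in>{0<..<1}. frac_Sobolev \<Omega> s p)"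
    using that gagliardo_tendsto[OF assms(1) _ assms(2)] by auto
  have radial_bounded_frontier: "radial_limits_exist \<Omega>" if "bounded (frontier \<Omega>)"
    using ray_limits_exist_bounded_frontier[OF that] by (simp add: radial_limits_exist_iff)

  {
    assume "radial_limits_exist \<Omega> \<and> u \<in> (\<Union>s\<in>{0<..<1}. weighted_Lp_space \<Omega> s p)"
    then show "((\<lambda>s. ennreal s *
           (\<integral>\<^sup>+x\<in>\<Omega>. ennreal (\<bar>u x\<bar> powr p) *
              (\<integral>\<^sup>+y\<in>- \<Omega>. ennreal (1 / norm (x - y) powr (real DIM('a) + s * p)) \<partial>lebesgue) \<partial>lebesgue))
        \<longlongrightarrow> ennreal (1 / p) *
           (\<integral>\<^sup>+x\<in>\<Omega>. ennreal (\<bar>u x\<bar> powr p * sphere_area (escape_sector \<Omega> x)) \<partial>lebesgue))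
        (at_right 0)"
      using escape_term_tendsto[OF assms(1) _ assms(2,3)] by auto
  next
    assume "radial_limits_exist \<Omega> \<and>
      u \<in> (\<Union>s\<in>{0<..<1}. frac_Sobolev \<Omega> s p \<inter> weighted_Lp_space \<Omega> s p)"
    then show "((\<lambda>s. ennreal (s * (1 - s)) * gagliardo \<Omega> s p u)
        \<longlongrightarrow> ennreal (2 / p) *
           (\<integral>\<^sup>+x\<in>\<Omega>. ennreal ((sphere_area (sphere 0 1 :: 'a set) - sphere_area (escape_sector \<Omega> x))
              * \<bar>u x\<bar> powr p) \<partial>lebesgue)) (at_right 0)"
      by (intro sector_limit) auto
  next
    assume "(compact (frontier \<Omega>) \<and> Lipschitz_boundary \<Omega> \<or>
        (\<exists>\<zeta>. Lipschitz_off e \<zeta> \<and> \<Omega> = epigraph_along e \<zeta>) \<and> radial_limits_exist \<Omega>) \<and>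
      u \<in> (\<Union>s\<in>{0<..<1}. frac_Sobolev \<Omega> s p)"
    then show "((\<lambda>s. ennreal (s * (1 - s)) * gagliardo \<Omega> s p u)
        \<longlongrightarrow> ennreal (2 / p) *
           (\<integral>\<^sup>+x\<in>\<Omega>. ennreal ((sphere_area (sphere 0 1 :: 'a set) - sphere_area (escape_sector \<Omega> x))
              * \<bar>u x\<bar> powr p) \<partial>lebesgue)) (at_right 0)"
      using radial_bounded_frontier compact_imp_bounded by (intro sector_limit) auto
  next
    assume hyp: "u \<in> (\<Union>s\<in>{0<..<1}. frac_Sobolev \<Omega> s p \<inter> weighted_Lp_space \<Omega> s p) \<or>
      (compact (frontier \<Omega>) \<and> Lipschitz_boundary \<Omega> \<or>
        (\<exists>\<zeta>. Lipschitz_off e \<zeta> \<and> \<Omega> = epigraph_along e \<zeta>)) \<and>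
      u \<in> (\<Union>s\<in>{0<..<1}. frac_Sobolev \<Omega> s p)"
    then have u: "u \<in> (\<Union>s\<in>{0<..<1}. frac_Sobolev \<Omega> s p)" by auto
    \<comment> \<open>In each of the three special domains the area of the escape sector does not depend on the point.\<close>
    have const_sector: "((\<lambda>s. ennreal (s * (1 - s)) * gagliardo \<Omega> s p u)
        \<longlongrightarrow> ennreal (2 * (sphere_area (sphere 0 1 :: 'a set) - A) / p) *
           (\<integral>\<^sup>+x\<in>\<Omega>. ennreal (\<bar>u x\<bar> powr p) \<partial>lebesgue)) (at_right 0)"
      if rad: "radial_limits_exist \<Omega>" and A: "\<And>x. x \<in> \<Omega> \<Longrightarrow> sphere_area (escape_sector \<Omega> x) = A"
        and le: "A \<le> sphere_area (sphere 0 1 :: 'a set)" for A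
    proof -
      have \<Omega>: "\<Omega> \<in> sets lebesgue" using assms(1) by simp
      have meas: "(\<lambda>x. ennreal (\<bar>u x\<bar> powr p) * indicator \<Omega> x) \<in> borel_measurable lebesgue"
      proof -
        have [measurable]: "u \<in> borel_measurable (lebesgue_on \<Omega>)"
          using assms(3) by (simp add: Lp_space_def)
        have "(\<lambda>x. ennreal (\<bar>u x\<bar> powr p)) \<in> borel_measurable (lebesgue_on \<Omega>)" by measurable
        then show ?thesis
          using \<Omega> by (subst (asm) borel_measurable_restrict_space_iff_ennreal) auto
      qed
      define S where "S = sphere_area (sphere 0 1 :: 'a set)"
      have "(\<integral>\<^sup>+x\<in>\<Omega>. ennreal ((S - sphere_area (escape_sector \<Omega> x)) * \<bar>u x\<bar> powr p) \<partial>lebesgue)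
        = (\<integral>\<^sup>+x. ennreal (S - A) * (ennreal (\<bar>u x\<bar> powr p) * indicator \<Omega> x) \<partial>lebesgue)"
        using A le by (intro nn_integral_cong) (auto simp: indicator_def S_def ennreal_mult)
      also have "\<dots> = ennreal (S - A) * (\<integral>\<^sup>+x\<in>\<Omega>. ennreal (\<bar>u x\<bar> powr p) \<partial>lebesgue)"
        by (rule nn_integral_cmult[OF meas])
      finally have "ennreal (2 / p) * (\<integral>\<^sup>+x\<in>\<Omega>. ennreal ((S - sphere_area (escape_sector \<Omega> x)) * \<bar>u x\<bar> powr p) \<partial>lebesgue)
        = ennreal (2 * (S - A) / p) * (\<integral>\<^sup>+x\<in>\<Omega>. ennreal (\<bar>u x\<bar> powr p) \<partial>lebesgue)"
        using assms(2) le by (simp add: mult.assoc[symmetric] S_def flip: ennreal_mult)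
      then show ?thesis using sector_limit[OF rad u] by (simp add: S_def)
    qed
    show "((\<lambda>s. ennreal (s * (1 - s)) * gagliardo \<Omega> s p u) \<longlongrightarrow> 0) (at_right 0)" if "bounded \<Omega>"
      using const_sector[OF radial_bounded_frontier, of "sphere_area (sphere 0 1 :: 'a set)"]
        bounded_frontier_of_bounded[OF that] escape_sector_bounded[OF that] by simp
    show "((\<lambda>s. ennreal (s * (1 - s)) * gagliardo \<Omega> s p u)
          \<longlongrightarrow> ennreal (2 * sphere_area (sphere 0 1 :: 'a set) / p) *
             (\<integral>\<^sup>+x\<in>\<Omega>. ennreal (\<bar>u x\<bar> powr p) \<partial>lebesgue)) (at_right 0)" if "bounded (- \<Omega>)"
      using const_sector[OF radial_bounded_frontier, of 0]
        bounded_frontier_of_bounded[OF that] escape_sector_bounded_complement[OF that]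
      by (simp add: sphere_area_def)
    show "((\<lambda>s. ennreal (s * (1 - s)) * gagliardo \<Omega> s p u)
          \<longlongrightarrow> ennreal (sphere_area (sphere 0 1 :: 'a set) / p) *
             (\<integral>\<^sup>+x\<in>{x. x \<bullet> e > 0}. ennreal (\<bar>u x\<bar> powr p) \<partial>lebesgue)) (at_right 0)" if half: "\<Omega> = {x. x \<bullet> e > 0}"
    proof -
      have e: "e \<noteq> 0" using assms(4) by auto
      have "radial_limits_exist \<Omega>"
        unfolding half radial_limits_exist_iff using ray_limits_exist_halfspace[OF e] by simp
      moreover have "sphere_area (escape_sector \<Omega> x) = sphere_area (sphere 0 1 :: 'a set) / 2" if "x \<in> \<Omega>" for x
        using that escape_sector_halfspace[of x e] sphere_area_half[OF e] by (simp add: half)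
      ultimately show ?thesis
        using const_sector[of "sphere_area (sphere 0 1 :: 'a set) / 2"]
        by (simp add: half sphere_area_def)
    qed
  }
qed

end
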